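(* Let $n\ge 3$ and let $t\in\mathbb{R}$ satisfy $\sqrt{\frac{n-1}{2(n+1)}}<t\le\sqrt{\frac{n}{n+1}}$. Let $a^{(n)}:=\big(\sqrt{\tfrac{n}{n+1}},-\tfrac{1}{\sqrt{n(n+1)}},\dots,-\tfrac{1}{\sqrt{n(n+1)}}\big)\in\mathbb{R}^{n+1}$. Then for all $a\in\mathcal{S}_n$, $$A(a,t)\le A(a^{(n)},t)=\frac{\sqrt{n+1}}{(n-1)!}\Big(\frac{n}{n+1}\Big)^{n/2}\Big(\sqrt{\tfrac{n}{n+1}}-t\Big)^{n-1},$$ and, up to permutations of the coordinates of $a^{(n)}$, $a^{(n)}$ is the unique maximizer of $A(\cdot,t)$ on $\mathcal{S}_n$. For $n=2$ the same statement holds if $\frac54\cdot\frac{1}{\sqrt6}\le t\le\sqrt{\frac23}$, while for $n=2$ and $\frac1{\sqrt6}<t<\frac54\cdot\frac1{\sqrt6}$ the inequality $A(a,t)\le A(a^{(2)},t)$ fails for some $a\in\mathcal{S}_2$.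
   Context: The regular $n$-simplex is $\Delta^n=\{x\in\mathbb{R}^{n+1}: x_j\ge0,\ \sum_{j=1}^{n+1}x_j=1\}$, with centroid $c=\frac1{n+1}(1,\dots,1)$. Let $\mathcal{S}_n=\{a\in\mathbb{R}^{n+1}:\|a\|_2=1,\ \sum_{j=1}^{n+1}a_j=0\}$. For $a\in\mathcal{S}_n$ and $t\in\mathbb{R}$, $H_t(a)=\{x\in\mathbb{R}^{n+1}:\langle a,x\rangle=t\}$ (a hyperplane at distance $t$ from $c$), and the parallel section function is $A(a,t)=\mathrm{vol}_{n-1}(H_t(a)\cap\Delta^n)$.
   Formalization: Uniqueness of the maximizer (up to permutations) is claimed only for t < √(n/(n+1)); at t = √(n/(n+1)) every section is empty or a single point, so A(a,t) = 0 for all a and uniqueness fails there. *)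

theory Defs
  imports "HOL-Analysis.Analysis"
begin

text \<open>Points of R^(n+1) are modelled as vectors of type real^'m with CARD('m) = n+1.\<close>

definition std_simplex :: "(real^'m) set" where
  "std_simplex = {x. (\<forall>j. 0 \<le> x $ j) \<and> (\<Sum>j\<in>UNIV. x $ j) = 1}"

definition S_sph :: "(real^'m) set" where
  "S_sph = {a. norm a = 1 \<and> (\<Sum>j\<in>UNIV. a $ j) = 0}"

definition hyp :: "real^'m \<Rightarrow> real \<Rightarrow> (real^'m) set" where
  "hyp a t = {x. inner a x = t}"

text \<open>DIM('k)-dimensional volume of a set S contained in a DIM('k)-dimensional affine
  subspace P of a Euclidean space: Lebesgue measure of the image of S under an isometry
  of P onto the Euclidean space 'k (independent of the choice of isometry).\<close>

definition flat_vol :: "'k::euclidean_space itself \<Rightarrow> 'a::euclidean_space set \<Rightarrow> 'a set \<Rightarrow> real" where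
  "flat_vol _ P S =
     measure lebesgue
       ((SOME f :: 'a \<Rightarrow> 'k. (\<forall>x\<in>P. \<forall>y\<in>P. dist (f x) (f y) = dist x y) \<and> f ` P = UNIV) ` S)"

text \<open>Parallel section function A(a,t) = vol_(n-1)(H_t(a) \<inter> \<Delta>^n), where the target
  type 'k has dimension n-1 and H_t(a) \<inter> \<Delta>^n lies in the (n-1)-dimensional affine
  subspace H_t(a) \<inter> {x. sum x = 1}.\<close>

definition sec_area :: "'k::finite itself \<Rightarrow> real^'m \<Rightarrow> real \<Rightarrow> real" where
  "sec_area _ a t =
     flat_vol TYPE(real^'k) (hyp a t \<inter> {x. (\<Sum>j\<in>UNIV. x $ j) = 1}) (hyp a t \<inter> std_simplex)"

definition a_star :: "'m::finite \<Rightarrow> real^'m" where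
  "a_star i = (\<chi> j. if j = i then sqrt (real (CARD('m) - 1) / real (CARD('m)))
                    else - 1 / sqrt (real (CARD('m) - 1) * real (CARD('m))))"

end

theory Submission
  imports Defs
begin

text \<open>A level \<open>t\<close> above \<open>sqrt ((n - 1) / (2 * (n + 1)))\<close>, the distance from the centroid to the
  midpoint of an edge, is exceeded by at most one coordinate \<open>a\<^sub>i\<close> of \<open>a\<close>. If there is one, the section cuts
  off a single vertex, and the double cone over it with apexes \<open>e\<^sub>i\<close> and \<open>0\<close> is the image of the standard
  simplex under a stretch followed by a shear. Comparing volumes gives
  \<open>A(a,t) = sqrt (n + 1) / (n - 1)! * (a\<^sub>i - t)^(n - 1) / (\<Prod>j\<noteq>i. a\<^sub>i - a\<^sub>j)\<close>.
  The factors \<open>a\<^sub>i - a\<^sub>j\<close> have a mean and a variance determined by \<open>a\<^sub>i\<close>, which bounds their product from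
  below; what remains is a one-variable inequality, strict unless \<open>a\<^sub>i\<close> is as large as possible.\<close>

subsection \<open>Lebesgue measure of isometric images, cones and shears\<close>

text \<open>\<open>flat_vol\<close> measures a section through an arbitrarily chosen isometry, known
  only to preserve distances. Coning twice gives a set of full dimension: the inner cone, of height
  \<open>a $ i - t\<close>, is the cap of the simplex at \<open>e\<^sub>i\<close>; the outer one, of
  height \<open>1 / sqrt (n + 1)\<close>, joins the cap to 0. The chosen isometry extends to the
  whole space, so the choice drops out. With X = sqrt (n / (n + 1)), the circumradius, the gaps
  \<open>X * (a\<^sub>i - a\<^sub>j)\<close> have mean \<open>y = a\<^sub>i / X\<close>, and their
  squared deviations sum to \<open>n / (n + 1) * (1 - y^2)\<close>. The coefficient
  \<open>(n - 1) / n\<close> in the product bound makes the bound vanish exactly when these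
  deviations permit a zero gap, which is the direction of an edge midpoint. For n = 2 the bound is
  an identity, so the one-variable inequality decides. Its two sides agree at y = 1; removing the
  factor 1 - y leaves a condition linear in y, which at y = 1 yields the level 5/8 in units of X,
  that is t = 5/4 * 1 / sqrt 6. For n \<ge> 3 the edge midpoints lie above level 1/2, and this
  suffices for the whole range.\<close>

text \<open>By Vitali, \<open>S\<close> is covered up to a null set by disjoint balls inside an open
  set of nearly the same measure. \<open>T\<close> maps each to a ball of the same radius, whose
  volume depends only on the dimension, and being Lipschitz it keeps the null set null.\<close>

lemma emeasure_isometry_image_le:
  fixes T :: "'a::euclidean_space \<Rightarrow> 'b::euclidean_space"
  assumes dim: "DIM('a) = DIM('b)" and iso: "\<And>x y. dist (T x) (T y) = dist x y"
    and surj: "surj T" and S: "S \<in> sets lebesgue" and TS: "T ` S \<in> sets lebesgue"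
  shows "emeasure lebesgue (T ` S) \<le> emeasure lebesgue S"
proof (rule ennreal_le_epsilon)
  fix e :: real assume "e > 0"
  then obtain U where U: "open U" "S \<subseteq> U" "U - S \<in> lmeasurable"
      "emeasure lebesgue (U - S) < ennreal e"
    using sets_lebesgue_outer_open[OF S] by blast
  have ball_img: "T ` ball x r = ball (T x) r" for x r
  proof
    show "ball (T x) r \<subseteq> T ` ball x r"
    proof
      fix y assume y: "y \<in> ball (T x) r"
      obtain z where "y = T z" using surj by (meson surjD)
      then show "y \<in> T ` ball x r" using y iso by auto
    qed
  qed (auto simp: iso)
  have inj: "inj T" by (rule injI) (metis iso dist_eq_0_iff)
  define K where "K = {(x,r). ball x r \<subseteq> U}"
  have "\<exists>i. i \<in> K \<and> x \<in> ball (fst i) (snd i) \<and> snd i < d" if "x \<in> S" "0 < d" for x d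
  proof -
    obtain r where r: "r > 0" "ball x r \<subseteq> U"
      using \<open>open U\<close> \<open>S \<subseteq> U\<close> \<open>x \<in> S\<close> open_contains_ball by blast
    have "ball x (min r (d/2)) \<subseteq> U" using r by auto
    then have "(x, min r (d/2)) \<in> K" by (simp add: K_def)
    moreover have "x \<in> ball x (min r (d/2))" "min r (d/2) < d" using r \<open>0 < d\<close> by auto
    ultimately show ?thesis by (metis fst_conv snd_conv)
  qed
  then obtain C where C: "countable C" "C \<subseteq> K"
     "pairwise (\<lambda>i j. disjnt (ball (fst i) (snd i)) (ball (fst j) (snd j))) C"
     and neg: "negligible (S - (\<Union>i \<in> C. ball (fst i) (snd i)))"
    by (rule Vitali_covering_theorem_balls)
  let ?N = "S - (\<Union>i \<in> C. ball (fst i) (snd i))"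
  let ?B = "\<lambda>i. ball (fst i) (snd i)" and ?B' = "\<lambda>i. ball (T (fst i)) (snd i)"
  have disj: "disjoint_family_on ?B C"
    using C(3) by (auto simp: disjoint_family_on_def pairwise_def disjnt_def)
  have disj': "disjoint_family_on ?B' C"
    using disj unfolding disjoint_family_on_def ball_img[symmetric]
    by (metis image_Int[OF inj] image_empty)
  have "negligible (T ` ?N)"
  proof (rule negligible_locally_Lipschitz_image[OF _ neg])
    show "\<exists>V B. open V \<and> x \<in> V \<and> (\<forall>y\<in>?N \<inter> V. norm (T y - T x) \<le> B * norm (y - x))" for x
      by (rule exI[of _ UNIV], rule exI[of _ 1]) (use iso in \<open>auto simp: dist_norm\<close>)
  qed (simp add: dim)
  then have null: "T ` ?N \<in> null_sets lebesgue" by (simp add: negligible_iff_null_sets)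
  \<comment> \<open>\<open>K\<close> admits negative radii; both balls are then empty.\<close>
  have emB: "emeasure lebesgue (?B' i) = emeasure lebesgue (?B i)" for i
  proof (cases "0 \<le> snd i")
    case True then show ?thesis using dim by (simp add: emeasure_ball)
  qed (simp add: ball_empty)
  have "T ` S \<subseteq> (\<Union>i\<in>C. ?B' i) \<union> T ` ?N"
    unfolding ball_img[symmetric] image_UN[symmetric] image_Un[symmetric] by (rule image_mono) auto
  then have "emeasure lebesgue (T ` S) \<le> emeasure lebesgue ((\<Union>i\<in>C. ?B' i) \<union> T ` ?N)"
    using C(1) null by (intro emeasure_mono sets.Un) auto
  also have "\<dots> = emeasure lebesgue (\<Union>i\<in>C. ?B' i)"
    using C(1) null by (intro emeasure_Un_null_set) auto
  also have "\<dots> = (\<integral>\<^sup>+i. emeasure lebesgue (?B' i) \<partial>count_space C)"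
    using disj' C(1) by (intro emeasure_UN_countable) auto
  also have "\<dots> = (\<integral>\<^sup>+i. emeasure lebesgue (?B i) \<partial>count_space C)"
    by (simp only: emB)
  also have "\<dots> = emeasure lebesgue (\<Union>i\<in>C. ?B i)"
    using disj C(1) by (intro emeasure_UN_countable[symmetric]) auto
  also have "\<dots> \<le> emeasure lebesgue U"
    using C(2) U(1) by (intro emeasure_mono) (force simp: K_def)+
  also have "\<dots> = emeasure lebesgue (S \<union> (U - S))"
    using U by (simp add: Un_absorb1)
  also have "\<dots> \<le> emeasure lebesgue S + emeasure lebesgue (U - S)"
    using S U by (intro emeasure_subadditive) auto
  also have "\<dots> \<le> emeasure lebesgue S + ennreal e"
    using U by (intro add_left_mono) auto
  finally show "emeasure lebesgue (T ` S) \<le> emeasure lebesgue S + ennreal e" .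
qed

lemma isometry_imp_continuous_on:
  fixes T :: "'a::metric_space \<Rightarrow> 'b::metric_space"
  assumes "\<And>x y. x \<in> S \<Longrightarrow> y \<in> S \<Longrightarrow> dist (T x) (T y) = dist x y"
  shows "continuous_on S T"
  unfolding continuous_on_iff using assms by metis

lemma measure_isometry_image:
  fixes T :: "'a::euclidean_space \<Rightarrow> 'b::euclidean_space"
  assumes dim: "DIM('a) = DIM('b)" and iso: "\<And>x y. dist (T x) (T y) = dist x y"
    and surj: "surj T" and S: "compact S"
  shows "measure lebesgue (T ` S) = measure lebesgue S"
proof -
  have inj: "inj T" by (rule injI) (metis iso dist_eq_0_iff)
  have TS: "compact (T ` S)"
    using S iso by (intro compact_continuous_image isometry_imp_continuous_on) auto
  have sets: "S \<in> sets lebesgue" "T ` S \<in> sets lebesgue"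
    using S TS by (auto dest: compact_imp_closed)
  have inv: "inv T ` T ` S = S" using inj by (simp add: image_comp)
  have isoi: "dist (inv T x) (inv T y) = dist x y" for x y
    using surj iso by (metis surj_f_inv_f)
  have "emeasure lebesgue (inv T ` T ` S) \<le> emeasure lebesgue (T ` S)"
    using dim isoi sets inv by (intro emeasure_isometry_image_le inj_imp_surj_inv[OF inj]) simp_all
  moreover have "emeasure lebesgue (T ` S) \<le> emeasure lebesgue S"
    by (rule emeasure_isometry_image_le[OF dim iso surj sets])
  ultimately show ?thesis unfolding inv measure_def by simp
qed

text \<open>Cavalieri: the slice at height \<open>y\<close> is \<open>S\<close> scaled by
  \<open>y / h\<close>, so its measure carries the factor \<open>(y / h) ^ DIM('a)\<close>.\<close>

lemma measure_cone:
  fixes S :: "'a::euclidean_space set"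
  assumes S: "compact S" and h: "h > 0"
  shows "measure lebesgue ((\<lambda>(x,s). (s *\<^sub>R x, s * h)) ` (S \<times> {0..1::real}))
           = h * measure lebesgue S / (DIM('a) + 1)" (is "measure lebesgue ?C = _")
proof -
  let ?k = "DIM('a)"
  have comp: "compact ?C"
    using S by (intro compact_continuous_image compact_Times)
      (auto simp: case_prod_unfold intro!: continuous_intros)
  have sets: "?C \<in> sets borel" "S \<in> sets borel"
    using comp S by (auto dest: compact_imp_closed)
  \<comment> \<open>Height 0, where the scaling degenerates, is a single height and does not affect
    the integral.\<close>
  have slice: "emeasure lborel ((\<lambda>x. (x, y)) -` ?C) = 
      ennreal (measure lebesgue S) * (ennreal ((y / h) ^ ?k) * indicator {0..h} y)" if "y \<noteq> 0" for y
  proof (cases "y \<in> {0..h}")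
    case True
    then have "(\<lambda>x. (x, y)) -` ?C = (\<lambda>x. (y / h) *\<^sub>R x) ` S"
      using h that by (force simp: image_iff field_simps)
    moreover have "emeasure lebesgue ((\<lambda>x. (y / h) *\<^sub>R x) ` S) = ennreal ((y/h) ^ ?k) * emeasure lebesgue S"
      using emeasure_lebesgue_affine[of "y/h" 0 S] True h by simp
    moreover have "emeasure lebesgue S = ennreal (measure lebesgue S)"
      using lmeasurable_compact[OF S] by (simp add: emeasure_eq_measure2)
    moreover have "(\<lambda>x. (x, y)) -` ?C \<in> sets borel"
      using sets(1) by (intro measurable_sets_borel[OF borel_measurable_continuous_onI] continuous_intros)
    ultimately show ?thesis using True by (simp add: mult.commute)
  next
    case False
    then have "(\<lambda>x. (x, y)) -` ?C = {}" 
      using h by (auto simp: mult_left_le_one_le)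
    then show ?thesis using False by simp
  qed
  have "emeasure lebesgue ?C = emeasure (lborel \<Otimes>\<^sub>M lborel) ?C"
    using sets by (simp add: lborel_prod)
  also have "\<dots> = (\<integral>\<^sup>+y. emeasure lborel ((\<lambda>x. (x, y)) -` ?C) \<partial>lborel)"
    by (rule lborel_pair.emeasure_pair_measure_alt2) (use sets in \<open>simp only: lborel_prod sets_lborel\<close>)
  also have "\<dots> = (\<integral>\<^sup>+y. ennreal (measure lebesgue S) * (ennreal ((y / h) ^ ?k) * indicator {0..h} y) \<partial>lborel)"
    by (rule nn_integral_cong_AE) (use AE_lborel_singleton[of 0] slice in \<open>auto elim!: eventually_mono\<close>)
  also have "\<dots> = ennreal (measure lebesgue S) * (\<integral>\<^sup>+y. ennreal ((y / h) ^ ?k) * indicator {0..h} y \<partial>lborel)"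
    by (rule nn_integral_cmult) auto
  also have "(\<integral>\<^sup>+y. ennreal ((y / h) ^ ?k) * indicator {0..h} y \<partial>lborel)
      = ennreal (h / (?k+1) * (h/h) ^ (?k+1) - h / (?k+1) * (0/h) ^ (?k+1))"
  proof (rule nn_integral_FTC_Icc[where F = "\<lambda>y. h / (?k+1) * (y/h) ^ (?k+1)"])
    fix x assume "x \<in> {0..h}"
    have "DERIV (\<lambda>y. h / (?k+1) * (y/h) ^ (?k+1)) x :> h / (?k+1) * (real (?k+1) * (x / h) ^ ?k * (1 / h))"
      by (rule derivative_eq_intros refl | use h in \<open>simp add: divide_simps\<close>)+
    moreover have "h / (?k+1) * (real (?k+1) * z * (1 / h)) = z" for z
      using h by (simp add: divide_simps)
    ultimately show "DERIV (\<lambda>y. h / (?k+1) * (y/h) ^ (?k+1)) x :> (x / h) ^ ?k"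
      by metis
  qed (use h in auto)
  also have "\<dots> = ennreal (h / (?k+1))" using h by simp
  also have "ennreal (measure lebesgue S) * \<dots> = ennreal (h * measure lebesgue S / (?k+1))"
    using h by (simp add: ennreal_mult'[symmetric] mult.commute)
  finally show ?thesis using h by (simp add: measure_def)
qed

text \<open>Fubini: over each \<open>x\<close> the fibre is only translated, by
  \<open>\<phi> x\<close>.\<close>

lemma measure_shear_prod:
  fixes K :: "('a::euclidean_space \<times> real) set" and \<phi> :: "'a \<Rightarrow> real"
  assumes K: "compact K" and \<phi>: "continuous_on UNIV \<phi>"
  shows "measure lebesgue ((\<lambda>(x,r). (x, r + \<phi> x)) ` K) = measure lebesgue K" (is "measure lebesgue ?K = _")
proof -
  have comp: "compact ?K"
    using K by (intro compact_continuous_image)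
      (auto simp: case_prod_unfold intro!: continuous_intros continuous_on_compose2[OF \<phi>])
  have sets: "?K \<in> sets borel" "K \<in> sets borel"
    using comp K by (auto dest: compact_imp_closed)
  have "emeasure lebesgue ?K = emeasure (lborel \<Otimes>\<^sub>M lborel) ?K"
    using sets by (simp add: lborel_prod)
  also have "\<dots> = (\<integral>\<^sup>+x. emeasure lborel (Pair x -` ?K) \<partial>lborel)"
    by (rule lborel.emeasure_pair_measure_alt) (use sets in \<open>simp only: lborel_prod sets_lborel\<close>)
  also have "\<dots> = (\<integral>\<^sup>+x. emeasure lborel (Pair x -` K) \<partial>lborel)"
  proof (rule nn_integral_cong)
    fix x
    have s: "Pair x -` K \<in> sets borel" "Pair x -` ?K \<in> sets borel"
      using sets by (auto intro!: measurable_sets_borel[OF borel_measurable_continuous_onI] continuous_intros)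
    have "Pair x -` ?K = (\<lambda>r. \<phi> x + 1 *\<^sub>R r) ` (Pair x -` K)"
      by (force simp: image_iff)
    then have "emeasure lebesgue (Pair x -` ?K) = emeasure lebesgue (Pair x -` K)"
      using emeasure_lebesgue_affine[of 1 "\<phi> x" "Pair x -` K"] by (simp add: add.commute)
    then show "emeasure lborel (Pair x -` ?K) = emeasure lborel (Pair x -` K)"
      using s by simp
  qed
  also have "\<dots> = emeasure (lborel \<Otimes>\<^sub>M lborel) K"
    by (rule lborel.emeasure_pair_measure_alt[symmetric]) (use sets in \<open>simp only: lborel_prod sets_lborel\<close>)
  also have "\<dots> = emeasure lebesgue K"
    using sets by (simp add: lborel_prod)
  finally show ?thesis by (simp add: measure_def)
qed

section \<open>Double cones over sections of codimension two\<close>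

text \<open>Fixing 0, \<open>T\<close> preserves norms and, by polarization, inner products;
  \<open>vector_eq\<close> then tests each linearity equation by inner products alone.\<close>

lemma isometry_linear_general:
  fixes T :: "'a::real_inner \<Rightarrow> 'b::real_inner"
  assumes 0: "T 0 = 0" and iso: "\<And>x y. dist (T x) (T y) = dist x y"
  shows "linear T"
proof -
  have n: "norm (T x) = norm x" for x using iso[of x 0] 0 by simp
  have inner: "T x \<bullet> T y = x \<bullet> y" for x y
    using iso[of x y] by (simp add: dot_norm_neg n dist_norm)
  show ?thesis
  proof (rule linearI)
    show "T (x + y) = T x + T y" for x y
      by (subst vector_eq) (simp add: inner inner_add_left inner_add_right)
    show "T (c *\<^sub>R x) = c *\<^sub>R T x" for c x
      by (subst vector_eq) (simp add: inner)
  qed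
qed

text \<open>The set on the left is the double cone over the section with apexes \<open>e\<close> and \<open>0\<close>;
  its two heights are \<open>h\<close> and \<open>q\<close>.\<close>

lemma measure_double_cone:
  fixes a u e :: "'b::euclidean_space" and f :: "'b \<Rightarrow> 'c::euclidean_space"
  defines "P \<equiv> \<lambda>t q. {x. a \<bullet> x = t \<and> u \<bullet> x = q}"
  assumes dim: "DIM('b) = DIM('c) + 2"
    and au: "norm a = 1" "norm u = 1" "a \<bullet> u = 0"
    and iso: "\<And>x y. x \<in> P t q \<Longrightarrow> y \<in> P t q \<Longrightarrow> dist (f x) (f y) = dist x y"
    and surj: "f ` P t q = UNIV"
    and S: "S \<subseteq> P t q" "compact S" and e: "e \<in> P (t + h) q" and pos: "h > 0" "q > 0"
  shows "measure lebesgue ((\<lambda>((p,s),r). r *\<^sub>R (e + s *\<^sub>R (p - e))) ` ((S \<times> {0..1}) \<times> {0..1}))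
       = q * h * measure lebesgue (f ` S) / ((DIM('c) + 1) * (DIM('c) + 2))"
proof -
  have inn: "a \<bullet> a = 1" "u \<bullet> u = 1" "u \<bullet> a = 0" "a \<bullet> u = 0"
    using au by (auto simp: norm_eq_1 inner_commute)
  \<comment> \<open>The foot of the perpendicular from the apex \<open>e\<close> to the flat; it
    becomes the origin of the coordinates there.\<close>
  define x0 where "x0 = e - h *\<^sub>R a"
  have x0: "x0 \<in> P t q" using e inn by (simp add: P_def x0_def inner_diff_right)
  define g where "g = inv_into (P t q) f"
  have g: "g y \<in> P t q" "f (g y) = y" for y
    unfolding g_def using surj by (auto intro: inv_into_into f_inv_into_f)
  have inj: "x = y" if "f x = f y" "x \<in> P t q" "y \<in> P t q" for x y
    using iso[of x y] that by simp
  have gf: "g (f x) = x" if "x \<in> P t q" for x using inj g that by blast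
  have gd: "dist (g x) (g y) = dist x y" for x y using iso[of "g x" "g y"] g by simp
  \<comment> \<open>The inverse of \<open>f\<close>, recentred to fix 0: a linear isometry onto the
    directions of the flat.\<close>
  define T where "T v = g (v + f x0) - x0" for v
  have "linear T"
    by (rule isometry_linear_general) (use gd x0 gf in \<open>auto simp: T_def dist_norm\<close>)
  have Tn: "norm (T v) = norm v" for v
    using gd[of "v + f x0" "f x0"] gf[OF x0] by (simp add: T_def dist_norm)
  have To: "a \<bullet> T v = 0" "u \<bullet> T v = 0" "T v \<bullet> a = 0" "T v \<bullet> u = 0" for v
    using g(1)[of "v + f x0"] x0 inner_commute[of "T v"]
    by (auto simp: T_def P_def inner_diff_right)
  have TS: "T (f p - f x0) = p - x0" if "p \<in> P t q" for p
    using gf[OF that] by (simp add: T_def)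
  \<comment> \<open>Orthonormal coordinates: position parallel to the flat, descent along
    \<open>- a\<close>, and height along \<open>u\<close>. The two real coordinates serve as the
    axes of the two cones.\<close>
  define F :: "('c \<times> real) \<times> real \<Rightarrow> 'b" where
    "F = (\<lambda>z. T (fst (fst z)) - snd (fst z) *\<^sub>R a + snd z *\<^sub>R u)"
  have Fl: "linear F"
    unfolding F_def
    by (intro linearI) (simp_all add: linear_add[OF \<open>linear T\<close>] linear_scale[OF \<open>linear T\<close>] algebra_simps)
  have Fn: "norm (F z) = norm z" for z
  proof -
    have "norm (F z) ^ 2 = norm (T (fst (fst z))) ^ 2 + (snd (fst z))\<^sup>2 + (snd z)\<^sup>2"
      unfolding power2_norm_eq_inner F_def
      by (simp add: inn To inner_diff_left inner_diff_right inner_add_left inner_add_right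
          power2_eq_square)
    also have "\<dots> = norm z ^ 2"
      by (cases z; cases "fst z") (simp add: norm_prod_def Tn)
    finally show ?thesis by simp
  qed
  have Fiso: "dist (F x) (F y) = dist x y" for x y
    using Fn[of "x - y"] by (simp add: dist_norm linear_diff[OF Fl])
  have "\<exists>x. F x = y" for y
  proof -
    define y' where "y' = y - (a \<bullet> y) *\<^sub>R a - (u \<bullet> y) *\<^sub>R u"
    have "x0 + y' \<in> P t q" using x0 inn by (simp add: P_def y'_def inner_diff_right inner_add_right)
    then have "F ((f (x0 + y') - f x0, - (a \<bullet> y)), u \<bullet> y) = y"
      using TS by (simp add: F_def y'_def)
    then show ?thesis by blast
  qed
  then have Fsurj: "surj F" by (metis surj_def)
  \<comment> \<open>\<open>measure_cone\<close> has its apex at 0. Translating by \<open>z0\<close>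
    moves the inner apex to \<open>e\<close>, as seen from \<open>q *\<^sub>R u\<close>, the point
    of the hyperplane \<open>u \<bullet> x = q\<close> nearest to 0.\<close>
  obtain z0 where z0: "F (z0, 0) = e - q *\<^sub>R u"
  proof -
    obtain z where z: "F z = e - q *\<^sub>R u" using Fsurj by (metis surjD)
    have "u \<bullet> F z = snd z" by (simp add: F_def inner_add_right inner_diff_right To inn)
    then have "snd z = 0" using e inn by (simp add: z P_def inner_diff_right)
    then show ?thesis using z that[of "fst z"] by (metis prod.collapse)
  qed
  define S1 where "S1 = (\<lambda>p. f p - f x0) ` S"
  have fS: "compact (f ` S)"
    using S iso by (intro compact_continuous_image isometry_imp_continuous_on) auto
  have S1_eq: "S1 = (+) (- f x0) ` f ` S" by (auto simp: S1_def image_image)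
  have S1: "compact S1" using fS unfolding S1_eq by (rule compact_translation)
  have mS1: "measure lebesgue S1 = measure lebesgue (f ` S)"
    unfolding S1_eq by (rule measure_translation)
  define C1 where "C1 = (\<lambda>(x,s). (s *\<^sub>R x, s * h)) ` (S1 \<times> {0..1::real})"
  have C1: "compact C1" unfolding C1_def using S1
    by (intro compact_continuous_image compact_Times)
      (auto simp: case_prod_unfold intro!: continuous_intros)
  have mC1: "measure lebesgue C1 = h * measure lebesgue (f ` S) / (DIM('c) + 1)"
    unfolding C1_def using measure_cone[OF S1 pos(1)] mS1 by simp
  define S2 where "S2 = (+) z0 ` C1"
  have S2: "compact S2" using C1 unfolding S2_def by (rule compact_translation)
  have mS2: "measure lebesgue S2 = measure lebesgue C1"
    unfolding S2_def by (rule measure_translation)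
  define C2 where "C2 = (\<lambda>(x,s). (s *\<^sub>R x, s * q)) ` (S2 \<times> {0..1::real})"
  have C2: "compact C2" unfolding C2_def using S2
    by (intro compact_continuous_image compact_Times)
      (auto simp: case_prod_unfold intro!: continuous_intros)
  have mC2: "measure lebesgue C2 = q * measure lebesgue C1 / (DIM('c \<times> real) + 1)"
    unfolding C2_def using measure_cone[OF S2 pos(2)] mS2 by simp
  have pt: "F (r *\<^sub>R (z0 + (s *\<^sub>R (f p - f x0), s * h)), r * q) = r *\<^sub>R (e + s *\<^sub>R (p - e))"
    if "p \<in> S" for p r s
  proof -
    have "F (r *\<^sub>R (z0 + (s *\<^sub>R (f p - f x0), s * h)), r * q)
        = F (r *\<^sub>R ((z0, 0) + s *\<^sub>R ((f p - f x0, h), 0) + q *\<^sub>R (0,1)))"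
      by simp
    also have "\<dots> = r *\<^sub>R (F (z0,0) + s *\<^sub>R F ((f p - f x0, h), 0) + q *\<^sub>R F (0,1))"
      by (simp only: linear_add[OF Fl] linear_scale[OF Fl])
    also have "F ((f p - f x0, h), 0) = p - e"
      using TS[of p] S that by (auto simp: F_def x0_def)
    also have "F (0,1) = u" using linear_0[OF \<open>linear T\<close>] by (simp add: F_def)
    finally show ?thesis by (simp add: z0)
  qed
  have "(\<lambda>((p,s),r). r *\<^sub>R (e + s *\<^sub>R (p - e))) ` ((S \<times> {0..1}) \<times> {0..1}) = F ` C2" (is "?D = _")
  proof (intro subset_antisym subsetI)
    fix x assume "x \<in> ?D"
    then obtain p s r where *: "p \<in> S" "s \<in> {0..1}" "r \<in> {0..1}" "x = r *\<^sub>R (e + s *\<^sub>R (p - e))"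
      by auto
    have "(r *\<^sub>R (z0 + (s *\<^sub>R (f p - f x0), s * h)), r * q) \<in> C2"
      unfolding C2_def S2_def C1_def S1_def using * by (force simp: image_iff)
    then show "x \<in> F ` C2" using * pt by (metis imageI)
  next
    fix x assume "x \<in> F ` C2"
    then obtain p s r where *: "p \<in> S" "s \<in> {0..1}" "r \<in> {0..1}"
        "x = F (r *\<^sub>R (z0 + (s *\<^sub>R (f p - f x0), s * h)), r * q)"
      unfolding C2_def S2_def C1_def S1_def by auto
    then have "x = r *\<^sub>R (e + s *\<^sub>R (p - e))" using pt by blast
    then show "x \<in> ?D" using * by force
  qed
  moreover have "measure lebesgue (F ` C2) = measure lebesgue C2"
    by (rule measure_isometry_image) (use dim Fiso Fsurj C2 in auto)
  ultimately show ?thesis by (simp add: mC2 mC1 field_simps)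
qed

text \<open>Shows that the choice in \<open>flat_vol\<close> has a witness: the flat is a translate
  of the orthogonal complement of \<open>a\<close> and \<open>u\<close>, whose dimension is
  \<open>DIM('c)\<close>.\<close>

lemma exists_isometry_codim2_flat:
  fixes a u :: "'b::euclidean_space"
  assumes dim: "DIM('b) = DIM('c::euclidean_space) + 2"
    and au: "norm a = 1" "norm u = 1" "a \<bullet> u = 0"
  shows "\<exists>f :: 'b \<Rightarrow> 'c. (\<forall>x\<in>{x. a \<bullet> x = t \<and> u \<bullet> x = q}. \<forall>y\<in>{x. a \<bullet> x = t \<and> u \<bullet> x = q}.
             dist (f x) (f y) = dist x y) \<and> f ` {x. a \<bullet> x = t \<and> u \<bullet> x = q} = UNIV"
proof -
  have inn: "a \<bullet> a = 1" "u \<bullet> u = 1" "u \<bullet> a = 0" "a \<bullet> u = 0"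
    using au by (auto simp: norm_eq_1 inner_commute)
  define W where "W = {y. \<forall>x\<in>span {a,u}. orthogonal x y}"
  have W_eq: "W = {y. a \<bullet> y = 0 \<and> u \<bullet> y = 0}"
  proof -
    have "orthogonal x y" if "a \<bullet> y = 0" "u \<bullet> y = 0" "x \<in> span {a,u}" for x y
    proof -
      have "orthogonal y x" using that(3)
        by (rule orthogonal_to_span) (use that in \<open>auto simp: orthogonal_def inner_commute\<close>)
      then show ?thesis by (simp add: orthogonal_commute)
    qed
    moreover have "a \<in> span {a,u}" "u \<in> span {a,u}" by (simp_all add: span_base)
    ultimately show ?thesis unfolding W_def orthogonal_def by blast
  qed
  have ne: "a \<noteq> u" "a \<noteq> 0" "u \<noteq> 0" using inn by auto
  have "independent {a,u}"
    using ne inn by (intro pairwise_orthogonal_independent) (auto simp: pairwise_def orthogonal_def)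
  then have "dim (span {a,u}) = 2" using ne by (simp add: dim_eq_card_independent)
  then have dW: "dim W = DIM('c)"
    using dim_subspace_orthogonal_to_vectors[of "span {a,u}" "UNIV::'b set"] dim
    by (simp add: W_def)
  have "subspace W" unfolding W_eq by (auto simp: subspace_def inner_add_right)
  then obtain F :: "'b \<Rightarrow> 'c" where F: "linear F" "F ` W = UNIV" "\<And>x. x \<in> W \<Longrightarrow> norm (F x) = norm x"
    using isometry_subspaces[of W "UNIV :: 'c set"] dW by auto
  define x0 where "x0 = t *\<^sub>R a + q *\<^sub>R u"
  have P: "{x. a \<bullet> x = t \<and> u \<bullet> x = q} = (+) x0 ` W" (is "?P = _")
  proof -
    have "x - x0 \<in> W" if "x \<in> ?P" for x 
      using that by (simp add: W_eq x0_def inner_diff_right inner_add_right inn)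
    then have "?P \<subseteq> (+) x0 ` W" by (force simp: image_iff)
    moreover have "(+) x0 ` W \<subseteq> ?P" by (auto simp: W_eq x0_def inner_add_right inn)
    ultimately show ?thesis by blast
  qed
  show ?thesis
    unfolding P
  proof (intro exI conjI ballI)
    show "(\<lambda>x. F (x - x0)) ` (+) x0 ` W = UNIV" using F(2) by (simp add: image_image)
    fix x y assume "x \<in> (+) x0 ` W" "y \<in> (+) x0 ` W"
    then have "x - y \<in> W" using \<open>subspace W\<close> by (auto intro: subspace_diff)
    then show "dist (F (x - x0)) (F (y - x0)) = dist x y"
      using F(3) by (simp add: dist_norm linear_diff[OF F(1), symmetric])
  qed
qed

subsection \<open>Volume of a section that cuts off one vertex\<close>

text \<open>\<open>u\<close> is the unit normal of the hyperplane carrying the simplex. It supplies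
  the second normal of the flat, and \<open>1 / sqrt (n + 1)\<close> as distance of that hyperplane
  from 0.\<close>

lemma S_sph_inner:
  fixes a :: "real^'m"
  assumes "a \<in> S_sph"
  defines "u \<equiv> (\<chi> j. 1 / sqrt (real CARD('m))) :: real^'m"
  shows "norm a = 1" "norm u = 1" "a \<bullet> u = 0" 
    "(\<Sum>j\<in>UNIV. x $ j) = r \<longleftrightarrow> u \<bullet> x = r / sqrt (real CARD('m))"
proof -
  show "norm a = 1" using assms by (simp add: S_sph_def)
  have "(\<Sum>j\<in>UNIV. a $ j) = 0" using assms by (simp add: S_sph_def)
  then show "a \<bullet> u = 0" by (simp add: inner_vec_def u_def sum_divide_distrib[symmetric])
  show "norm u = 1" by (simp add: norm_eq_1 inner_vec_def u_def)
  show "(\<Sum>j\<in>UNIV. x $ j) = r \<longleftrightarrow> u \<bullet> x = r / sqrt (real CARD('m))"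
    by (simp add: inner_vec_def u_def sum_divide_distrib[symmetric])
qed

text \<open>The cone with apex 0 over the cap \<open>t \<le> a \<bullet> x\<close> of the simplex.
  Multiplying \<open>t\<close> by the coordinate sum makes the cap condition homogeneous.\<close>

definition sec_cone :: "real^'m \<Rightarrow> real \<Rightarrow> (real^'m) set" where
  "sec_cone a t = {x. (\<forall>j. 0 \<le> x $ j) \<and> (\<Sum>j\<in>UNIV. x $ j) \<le> 1 \<and> t * (\<Sum>j\<in>UNIV. x $ j) \<le> a \<bullet> x}"

lemma compact_std_simplex: "compact (std_simplex :: (real^'m) set)"
proof -
  have "closed (std_simplex :: (real^'m) set)"
    unfolding std_simplex_def
    by (intro closed_Collect_conj closed_Collect_all closed_Collect_le closed_Collect_eq continuous_intros)
  moreover have "bounded (std_simplex :: (real^'m) set)"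
  proof (rule boundedI)
    fix x :: "real^'m" assume x: "x \<in> std_simplex"
    have "norm x \<le> (\<Sum>j\<in>UNIV. \<bar>x $ j\<bar>)" by (rule norm_le_l1_cart)
    also have "\<dots> = 1" using x by (simp add: std_simplex_def)
    finally show "norm x \<le> 1" .
  qed
  ultimately show ?thesis by (simp add: compact_eq_bounded_closed)
qed

text \<open>Only the vertex \<open>e\<^sub>i\<close> lies beyond the section, so every segment from
  \<open>e\<^sub>i\<close> through another point of the cap can be prolonged to the section without
  leaving the simplex.\<close>

lemma sec_cone_eq_double_cone:
  fixes a :: "real^'m" and i :: 'm
  assumes ai: "t < a $ i" and aj: "\<And>j. j \<noteq> i \<Longrightarrow> a $ j < t"
    and k: "k \<noteq> i"
  shows "(\<lambda>((p,s),r). r *\<^sub>R (axis i 1 + s *\<^sub>R (p - axis i 1))) `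
           (((hyp a t \<inter> std_simplex) \<times> {0..1}) \<times> {0..1}) = sec_cone a t" (is "?D = _")
proof (intro subset_antisym subsetI)
  fix x assume "x \<in> ?D"
  then obtain p s r where *: "a \<bullet> p = t" "\<And>j. 0 \<le> p $ j" "(\<Sum>j\<in>UNIV. p $ j) = 1"
      "0 \<le> s" "s \<le> 1" "0 \<le> r" "r \<le> 1" and x: "x = r *\<^sub>R (axis i 1 + s *\<^sub>R (p - axis i 1))"
    by (auto simp: hyp_def std_simplex_def)
  define y where "y = axis i 1 + s *\<^sub>R (p - axis i 1)"
  have y1: "y $ j = (1 - s) * axis i 1 $ j + s * p $ j" for j
    by (simp add: y_def algebra_simps)
  have ax: "(\<Sum>j\<in>UNIV. axis i (1::real) $ j) = 1" by (simp add: axis_def)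
  have "0 \<le> y $ j" for j using * unfolding y1 by (simp add: axis_def)
  moreover have sy: "(\<Sum>j\<in>UNIV. y $ j) = 1"
    unfolding y1 sum.distrib sum_distrib_left[symmetric] using * ax by simp
  moreover have "a \<bullet> y = (1 - s) * a $ i + s * t"
    using * by (simp add: y_def inner_add_right inner_diff_right inner_axis algebra_simps)
  moreover have "(1 - s) * a $ i \<ge> (1 - s) * t" using * ai by (intro mult_left_mono) auto
  ultimately have y: "\<And>j. 0 \<le> y $ j" "a \<bullet> y \<ge> t" by (auto simp: algebra_simps)
  have "x = r *\<^sub>R y" using x y_def by simp
  moreover have "r * t \<le> r * (a \<bullet> y)" using y * by (intro mult_left_mono) auto
  ultimately show "x \<in> sec_cone a t"
    using y * sy by (simp add: sec_cone_def sum_distrib_left[symmetric] mult.commute)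
next
  fix x assume "x \<in> sec_cone a t"
  then have x: "\<And>j. 0 \<le> x $ j" "(\<Sum>j\<in>UNIV. x $ j) \<le> 1" "t * (\<Sum>j\<in>UNIV. x $ j) \<le> a \<bullet> x"
    by (auto simp: sec_cone_def)
  define r where "r = (\<Sum>j\<in>UNIV. x $ j)"
  have r: "0 \<le> r" "r \<le> 1" using x by (auto simp: r_def sum_nonneg)
  \<comment> \<open>Nonnegativity of coordinate \<open>i\<close> is automatic: if
    \<open>p $ i < 0\<close>, the remaining mass lies at levels below \<open>t\<close> and the total
    level would be less than \<open>t\<close>.\<close>
  have pt: "p \<in> hyp a t \<inter> std_simplex"
    if p: "a \<bullet> p = t" "\<And>j. j \<noteq> i \<Longrightarrow> 0 \<le> p $ j" "(\<Sum>j\<in>UNIV. p $ j) = 1" for p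
  proof -
    have "0 \<le> p $ i"
    proof (rule ccontr)
      assume "\<not> 0 \<le> p $ i"
      have "a \<bullet> p = a $ i * p $ i + (\<Sum>j\<in>UNIV - {i}. a $ j * p $ j)"
        by (simp add: inner_vec_def sum.remove[of UNIV i])
      also have "\<dots> \<le> a $ i * p $ i + (\<Sum>j\<in>UNIV - {i}. t * p $ j)"
        using p aj by (intro add_left_mono sum_mono mult_right_mono) (auto intro: less_imp_le)
      also have "\<dots> = a $ i * p $ i + t * (1 - p $ i)"
        using p(3) by (simp add: sum_distrib_left[symmetric] sum.remove[of UNIV i])
      also have "\<dots> = t + (a $ i - t) * p $ i" by (simp add: algebra_simps)
      also have "\<dots> < t" using \<open>\<not> 0 \<le> p $ i\<close> ai by (simp add: mult_pos_neg)
      finally show False using p by simp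
    qed
    then have "0 \<le> p $ j" for j using p(2) by (cases "j = i") auto
    then show ?thesis using p(1,3) by (simp add: hyp_def std_simplex_def)
  qed
  have ax: "(\<Sum>j\<in>UNIV. axis l (1::real) $ j) = 1" for l :: 'm by (simp add: axis_def)
  have D: "r *\<^sub>R (axis i 1 + s *\<^sub>R (p - axis i 1)) \<in> ?D"
    if "p \<in> hyp a t \<inter> std_simplex" "0 \<le> s" "s \<le> 1" for p s
    using that r by (intro image_eqI[where x = "((p,s),r)"]) auto
  \<comment> \<open>The apexes 0 and \<open>e\<^sub>i\<close> belong to the double cone only if the
    section is nonempty; the witness is where the edge from \<open>e\<^sub>i\<close> to
    \<open>e\<^sub>k\<close> meets level \<open>t\<close>.\<close>
  obtain p0 where p0: "p0 \<in> hyp a t \<inter> std_simplex"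
  proof
    define s where "s = (a $ i - t) / (a $ i - a $ k)"
    have s: "0 \<le> s" "s * (a $ k - a $ i) = t - a $ i"
      using ai aj[OF k] by (auto simp: s_def field_simps)
    show "axis i (1::real) + s *\<^sub>R (axis k 1 - axis i 1) \<in> hyp a t \<inter> std_simplex"
    proof (rule pt)
      show "a \<bullet> (axis i 1 + s *\<^sub>R (axis k 1 - axis i 1)) = t"
        using s by (simp add: inner_add_right inner_diff_right inner_axis)
      show "0 \<le> (axis i (1::real) + s *\<^sub>R (axis k 1 - axis i 1)) $ j" if "j \<noteq> i" for j
        using that s by (auto simp: axis_def)
      show "(\<Sum>j\<in>UNIV. (axis i (1::real) + s *\<^sub>R (axis k 1 - axis i 1)) $ j) = 1"
        by (simp add: sum.distrib sum_distrib_left[symmetric] sum_subtractf ax)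
    qed
  qed
  show "x \<in> ?D"
  proof (cases "r = 0")
    case True
    then have "x = 0" using x(1) by (simp add: r_def sum_nonneg_eq_0_iff vec_eq_iff)
    then show ?thesis using D[OF p0, of 0] True by simp
  next
    case False
    define y where "y = x /\<^sub>R r"
    have xy: "x = r *\<^sub>R y" using False by (simp add: y_def)
    have y: "\<And>j. 0 \<le> y $ j" "(\<Sum>j\<in>UNIV. y $ j) = 1" "t \<le> a \<bullet> y"
      using x r False unfolding y_def
      by (auto simp: sum_distrib_left[symmetric] sum_divide_distrib[symmetric] r_def[symmetric] divide_simps mult.commute)
    have gap: "a $ i - a \<bullet> y = (\<Sum>j\<in>UNIV. (a $ i - a $ j) * y $ j)"
      using y(2) by (simp add: inner_vec_def left_diff_distrib sum_subtractf sum_distrib_left[symmetric])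
    have gap_nn: "0 \<le> (a $ i - a $ j) * y $ j" for j
      using ai aj[of j] y(1)[of j] by (cases "j = i") auto
    \<comment> \<open>The fraction of the drop from level \<open>a $ i\<close> to level
      \<open>t\<close> completed at \<open>y\<close>; it is 0 only at the vertex
      \<open>e\<^sub>i\<close>.\<close>
    define s where "s = (a $ i - a \<bullet> y) / (a $ i - t)"
    have s: "0 \<le> s" "s \<le> 1"
      using ai y(3) sum_nonneg[of UNIV "\<lambda>j. (a $ i - a $ j) * y $ j"] gap_nn gap by (auto simp: s_def)
    show ?thesis
    proof (cases "s = 0")
      case True
      then have "(\<Sum>j\<in>UNIV. (a $ i - a $ j) * y $ j) = 0" using ai gap by (simp add: s_def)
      then have "(a $ i - a $ j) * y $ j = 0" for j
        using gap_nn by (simp add: sum_nonneg_eq_0_iff)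
      then have yj: "y $ j = 0" if "j \<noteq> i" for j
        using that ai aj[OF that] by (metis less_trans less_irrefl mult_eq_0_iff right_minus_eq)
      then have "y $ i = 1" using y(2) by (simp add: sum.remove[of UNIV i])
      with yj have "y = axis i 1" by (simp add: vec_eq_iff axis_def)
      then show ?thesis using D[OF p0, of 0] xy by simp
    next
      case False
      \<comment> \<open>The ray from \<open>e\<^sub>i\<close> through \<open>y\<close>, prolonged
        down to level \<open>t\<close>.\<close>
      define p where "p = axis i 1 + (y - axis i 1) /\<^sub>R s"
      have "p \<in> hyp a t \<inter> std_simplex"
      proof (rule pt)
        have "a \<bullet> p = a $ i - (a $ i - a \<bullet> y) / s"
          by (simp add: p_def inner_add_right inner_diff_right inner_axis divide_inverse algebra_simps)
        also have "(a $ i - a \<bullet> y) / s = a $ i - t" using False ai by (simp add: s_def field_simps)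
        finally show "a \<bullet> p = t" by simp
        show "0 \<le> p $ j" if "j \<noteq> i" for j using that s y(1) by (simp add: p_def axis_def)
        show "(\<Sum>j\<in>UNIV. p $ j) = 1"
          by (simp add: p_def sum.distrib sum_distrib_left[symmetric] sum_subtractf ax y(2))
      qed
      moreover have "y = axis i 1 + s *\<^sub>R (p - axis i 1)" using False by (simp add: p_def)
      ultimately show ?thesis using D s xy by metis
    qed
  qed
qed

section \<open>The cone over the cap as a stretched and sheared simplex\<close>

text \<open>Since \<open>\<phi> b = 0\<close>, \<open>\<phi>\<close> depends only on the component
  orthogonal to \<open>b\<close>. In orthonormal coordinates with \<open>b\<close> last, with
  \<open>'c\<close> for the orthogonal hyperplane, the map is the product shear above.\<close>

lemma measure_shear:
  fixes b :: "'b::euclidean_space" and \<phi> :: "'b \<Rightarrow> real"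
  assumes dim: "DIM('b) = DIM('c::euclidean_space) + 1" and b: "norm b = 1"
    and \<phi>: "linear \<phi>" "\<phi> b = 0" and K: "compact K"
  shows "measure lebesgue ((\<lambda>x. x + \<phi> x *\<^sub>R b) ` K) = measure lebesgue K"
proof -
  define W where "W = {x. b \<bullet> x = 0}"
  have bb: "b \<bullet> b = 1" using b by (simp add: norm_eq_1)
  have sW: "subspace W" unfolding W_def by (rule subspace_hyperplane)
  have dW: "dim W = DIM('c)"
    unfolding W_def using dim bb by (subst dim_hyperplane) auto
  obtain g :: "'c \<Rightarrow> 'b" where g: "linear g" "g ` UNIV = W" "\<And>x. norm (g x) = norm x"
    using isometry_subspaces[of "UNIV :: 'c set" W] sW dW by auto
  have gW: "b \<bullet> g x = 0" "g x \<bullet> b = 0" for x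
    using g(2) inner_commute[of b] by (auto simp: W_def)
  define F :: "'c \<times> real \<Rightarrow> 'b" where "F = (\<lambda>z. g (fst z) + snd z *\<^sub>R b)"
  have Fl: "linear F" unfolding F_def
    by (intro linearI) (simp_all add: linear_add[OF g(1)] linear_scale[OF g(1)] algebra_simps)
  have Fn: "norm (F z) = norm z" for z
  proof -
    have "norm (F z) ^ 2 = norm (g (fst z)) ^ 2 + (snd z)\<^sup>2"
      unfolding power2_norm_eq_inner F_def
      by (simp add: bb gW inner_add_left inner_add_right power2_eq_square)
    also have "\<dots> = norm z ^ 2"
      by (cases z) (simp add: norm_prod_def g(3))
    finally show ?thesis by simp
  qed
  have Fiso: "dist (F x) (F y) = dist x y" for x y
    using Fn[of "x - y"] by (simp add: dist_norm linear_diff[OF Fl])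
  have "\<exists>x. F x = y" for y
  proof -
    have "y - (b \<bullet> y) *\<^sub>R b \<in> W" by (simp add: W_def inner_diff_right bb)
    then obtain v where "g v = y - (b \<bullet> y) *\<^sub>R b" using g(2) by (metis imageE)
    then have "F (v, b \<bullet> y) = y" by (simp add: F_def)
    then show ?thesis by blast
  qed
  then have Fsurj: "surj F" by (metis surj_def)
  have invd: "dist (inv F x) (inv F y) = dist x y" for x y
    using Fiso[of "inv F x" "inv F y"] Fsurj by (simp add: surj_f_inv_f)
  define K' where "K' = inv F ` K"
  have FK': "F ` K' = K" using Fsurj by (simp add: K'_def image_f_inv_f)
  have K': "compact K'" unfolding K'_def
    using K invd by (intro compact_continuous_image isometry_imp_continuous_on) auto
  define \<psi> where "\<psi> v = \<phi> (g v)" for v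
  have "linear \<psi>" unfolding \<psi>_def using linear_compose[OF g(1) \<phi>(1)] by (simp add: o_def)
  then have \<psi>: "continuous_on UNIV \<psi>" by (simp add: linear_continuous_on linear_conv_bounded_linear)
  define K'' where "K'' = (\<lambda>(x,r). (x, r + \<psi> x)) ` K'"
  have K'': "compact K''" unfolding K''_def using K'
    by (intro compact_continuous_image)
      (auto simp: case_prod_unfold intro!: continuous_intros continuous_on_compose2[OF \<psi>])
  have "F (x, r + \<psi> x) = F (x, r) + \<phi> (F (x, r)) *\<^sub>R b" for x r
    using \<phi> by (simp add: F_def \<psi>_def linear_add linear_scale algebra_simps)
  then have "F ` K'' = (\<lambda>x. x + \<phi> x *\<^sub>R b) ` F ` K'"
    unfolding K''_def by (auto simp: image_image case_prod_unfold)
  then have "measure lebesgue ((\<lambda>x. x + \<phi> x *\<^sub>R b) ` K) = measure lebesgue (F ` K'')"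
    by (simp add: FK')
  also have "\<dots> = measure lebesgue K''"
    by (rule measure_isometry_image) (use dim Fiso Fsurj K'' in auto)
  also have "\<dots> = measure lebesgue K'"
    unfolding K''_def by (rule measure_shear_prod[OF K' \<psi>])
  also have "\<dots> = measure lebesgue (F ` K')"
    by (rule measure_isometry_image[symmetric]) (use dim Fiso Fsurj K' in auto)
  finally show ?thesis by (simp add: FK')
qed

lemma std_corner_simplex_cart:
  "convex hull (insert 0 Basis) = {x::real^'m. (\<forall>j. 0 \<le> x $ j) \<and> (\<Sum>j\<in>UNIV. x $ j) \<le> 1}"
proof -
  have B: "(Basis::(real^'m) set) = range (\<lambda>j. axis j 1)" by (auto simp: Basis_vec_def)
  have "sum ((\<bullet>) x) Basis = (\<Sum>j\<in>UNIV. x $ j)" for x :: "real^'m"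
    unfolding B by (subst sum.reindex) (auto simp: inj_on_def axis_eq_axis inner_axis)
  then show ?thesis unfolding std_simplex by (simp add: B inner_axis)
qed

lemma measure_weighted_corner_simplex:
  fixes m :: "'m::finite \<Rightarrow> real"
  assumes m: "\<And>j. 0 < m j"
  defines "K \<equiv> {x::real^'m. (\<forall>j. 0 \<le> x $ j) \<and> (\<Sum>j\<in>UNIV. x $ j / m j) \<le> 1}"
  shows "compact K" "measure lebesgue K = (\<Prod>j\<in>UNIV. m j) / fact CARD('m)"
proof -
  let ?S = "convex hull (insert 0 Basis) :: (real^'m) set"
  have cS: "compact ?S" by (intro finite_imp_compact_convex_hull) auto
  have K: "K = (\<lambda>x. \<chi> k. m k * x $ k) ` ?S"
  proof (intro subset_antisym subsetI)
    fix x assume "x \<in> K"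
    then have "x = (\<chi> k. m k * (\<chi> k. x $ k / m k) $ k)" "(\<chi> k. x $ k / m k) \<in> ?S"
      using m by (auto simp: vec_eq_iff K_def std_corner_simplex_cart less_imp_neq[OF m, symmetric] less_imp_le)
    then show "x \<in> (\<lambda>x. \<chi> k. m k * x $ k) ` ?S" by blast
  next
    fix x assume "x \<in> (\<lambda>x. \<chi> k. m k * x $ k) ` ?S"
    then show "x \<in> K"
      using m by (auto simp: K_def std_corner_simplex_cart less_imp_neq[OF m, symmetric] less_imp_le)
  qed
  show "compact K" unfolding K
    by (intro compact_continuous_image cS continuous_intros)
  have "measure lebesgue K = \<bar>prod m UNIV\<bar> * measure lebesgue ?S"
    unfolding K by (rule measure_stretch) (use cS in \<open>rule lmeasurable_compact\<close>)
  also have "measure lebesgue ?S = measure lborel ?S"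
    using cS by (intro measure_completion) (auto dest: compact_imp_closed)
  also have "\<dots> = 1 / fact CARD('m)" by (simp add: content_std_simplex)
  finally show "measure lebesgue K = (\<Prod>j\<in>UNIV. m j) / fact CARD('m)"
    using m by (simp add: abs_prod less_imp_le prod_nonneg)
qed

text \<open>The set is a simplex with vertices 0, \<open>e\<^sub>i\<close> and the points
  \<open>(1 - m\<^sub>j) e\<^sub>i + m\<^sub>j e\<^sub>j\<close> where the edges at
  \<open>e\<^sub>i\<close> cross level \<open>t\<close>. A shear along \<open>e\<^sub>i\<close>
  takes \<open>m\<^sub>j e\<^sub>j\<close> to these points.\<close>

lemma measure_sec_cone:
  fixes a :: "real^'m" and i :: 'm
  assumes dim: "CARD('m) = DIM('c::euclidean_space) + 1"
    and ai: "t < a $ i" and aj: "\<And>j. j \<noteq> i \<Longrightarrow> a $ j < t"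
  shows "measure lebesgue (sec_cone a t) =
           (\<Prod>j\<in>UNIV - {i}. (a $ i - t) / (a $ i - a $ j)) / fact CARD('m)"
proof -
  define m where "m j = (if j = i then 1 else (a $ i - t) / (a $ i - a $ j))" for j
  have m: "0 < m j" for j using ai aj[of j] by (auto simp: m_def)
  define K where "K = {x::real^'m. (\<forall>j. 0 \<le> x $ j) \<and> (\<Sum>j\<in>UNIV. x $ j / m j) \<le> 1}"
  note mK = measure_weighted_corner_simplex[of m, OF m, folded K_def]
  \<comment> \<open>Chosen so that \<open>m\<^sub>j e\<^sub>j\<close> receives the missing mass
    \<open>1 - m\<^sub>j\<close> in coordinate \<open>i\<close>.\<close>
  define \<phi> where "\<phi> x = (\<Sum>j\<in>UNIV. (1 / m j - 1) * x $ j)" for x :: "real^'m"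
  have \<phi>: "linear \<phi>" unfolding \<phi>_def
    by (intro linearI) (simp_all add: sum.distrib sum_distrib_left algebra_simps sum_subtractf)
  have \<phi>i: "\<phi> (axis i 1) = 0" unfolding \<phi>_def by (rule sum.neutral) (simp add: axis_def m_def)
  have mi: "m i = 1" by (simp add: m_def)
  have mj: "1 / m j - 1 = (t - a $ j) / (a $ i - t)" if "j \<noteq> i" for j
    using that ai aj[OF that] by (simp add: m_def field_simps)
  \<comment> \<open>Translates the cap condition into \<open>\<phi> x \<le> x $ i\<close>, which
    says that coordinate \<open>i\<close> was nonnegative before the shear.\<close>
  have \<phi>_eq: "(a $ i - t) * (\<phi> x - x $ i) = t * (\<Sum>j\<in>UNIV. x $ j) - a \<bullet> x" for x
  proof -
    have "\<phi> x = (\<Sum>j\<in>UNIV - {i}. (t - a $ j) / (a $ i - t) * x $ j)"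
      unfolding \<phi>_def by (subst sum.remove[of _ i]) (auto simp: mj mi)
    then have "(a $ i - t) * \<phi> x = (\<Sum>j\<in>UNIV - {i}. (t - a $ j) * x $ j)"
      using ai by (simp add: sum_distrib_left)
    moreover have "t * (\<Sum>j\<in>UNIV. x $ j) - a \<bullet> x = (\<Sum>j\<in>UNIV. (t - a $ j) * x $ j)"
      by (simp add: inner_vec_def sum_distrib_left sum_subtractf left_diff_distrib)
    moreover have "\<dots> = (t - a $ i) * x $ i + (\<Sum>j\<in>UNIV - {i}. (t - a $ j) * x $ j)"
      by (subst sum.remove[of _ i]) auto
    ultimately show ?thesis by (simp add: algebra_simps)
  qed
  have \<phi>nn: "0 \<le> \<phi> x" if "\<And>j. j \<noteq> i \<Longrightarrow> 0 \<le> x $ j" for x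
    unfolding \<phi>_def
  proof (rule sum_nonneg)
    fix j show "0 \<le> (1 / m j - 1) * x $ j"
    proof (cases "j = i")
      case False
      then show ?thesis unfolding mj[OF False] using ai aj[OF False] that[OF False] by simp
    qed (simp add: m_def)
  qed
  have sum_eq: "(\<Sum>j\<in>UNIV. x $ j / m j) = (\<Sum>j\<in>UNIV. x $ j) + \<phi> x" for x
    by (simp add: \<phi>_def sum.distrib[symmetric] algebra_simps)
  have "(\<lambda>x. x + \<phi> x *\<^sub>R axis i 1) ` K = sec_cone a t" (is "?f ` _ = _")
  proof (intro subset_antisym subsetI)
    fix y assume "y \<in> ?f ` K"
    then obtain x where x: "\<And>j. 0 \<le> x $ j" "(\<Sum>j\<in>UNIV. x $ j / m j) \<le> 1" and y: "y = ?f x"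
      by (auto simp: K_def)
    have \<phi>y: "\<phi> y = \<phi> x" unfolding y by (simp add: linear_add[OF \<phi>] linear_scale[OF \<phi>] \<phi>i)
    have yj: "y $ j = x $ j + (if j = i then \<phi> x else 0)" for j by (simp add: y axis_def)
    have "0 \<le> y $ j" for j using x(1)[of j] \<phi>nn[of x] x(1) by (simp add: yj)
    moreover have "(\<Sum>j\<in>UNIV. y $ j) \<le> 1" using x(2) by (simp add: yj sum.distrib sum_eq)
    moreover have "(a $ i - t) * (\<phi> y - y $ i) \<le> 0"
      using ai x(1)[of i] by (simp add: \<phi>y yj)
    ultimately show "y \<in> sec_cone a t" using \<phi>_eq[of y] by (simp add: sec_cone_def)
  next
    fix y assume "y \<in> sec_cone a t"
    then have y: "\<And>j. 0 \<le> y $ j" "(\<Sum>j\<in>UNIV. y $ j) \<le> 1" "t * (\<Sum>j\<in>UNIV. y $ j) \<le> a \<bullet> y"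
      by (auto simp: sec_cone_def)
    define x where "x = y - \<phi> y *\<^sub>R axis i 1"
    have \<phi>x: "\<phi> x = \<phi> y" unfolding x_def by (simp add: linear_diff[OF \<phi>] linear_scale[OF \<phi>] \<phi>i)
    have xj: "x $ j = y $ j - (if j = i then \<phi> y else 0)" for j by (simp add: x_def axis_def)
    have "(a $ i - t) * (\<phi> y - y $ i) \<le> 0" using \<phi>_eq[of y] y(3) by simp
    then have "\<phi> y \<le> y $ i" using ai by (simp add: mult_le_0_iff)
    then have "0 \<le> x $ j" for j using y(1)[of j] by (simp add: xj)
    moreover have "(\<Sum>j\<in>UNIV. x $ j / m j) \<le> 1"
      unfolding sum_eq \<phi>x using y(2) by (simp add: xj sum_subtractf)
    ultimately have "x \<in> K" by (simp add: K_def)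
    moreover have "y = ?f x" unfolding \<phi>x by (simp add: x_def)
    ultimately show "y \<in> ?f ` K" by blast
  qed
  moreover have "measure lebesgue (?f ` K) = measure lebesgue K"
    by (rule measure_shear[where 'c = 'c]) (use dim \<phi> \<phi>i mK(1) in auto)
  moreover have "(\<Prod>j\<in>UNIV. m j) = (\<Prod>j\<in>UNIV - {i}. (a $ i - t) / (a $ i - a $ j))"
    by (subst prod.remove[of _ i]) (auto simp: m_def)
  ultimately show ?thesis using mK(2) by simp
qed

lemma sec_area_eq:
  fixes a :: "real^'m" and i :: 'm
  assumes m: "CARD('m) = n + 1" and k: "CARD('k::finite) = n - 1" and a: "a \<in> S_sph"
    and ai: "t < a $ i" and aj: "\<And>j. j \<noteq> i \<Longrightarrow> a $ j < t"
  shows "sec_area TYPE('k) a t =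
     sqrt (real n + 1) / fact (n - 1) * ((a $ i - t) ^ (n - 1) / (\<Prod>j\<in>UNIV - {i}. a $ i - a $ j))"
proof -
  have "CARD('k) \<ge> 1" by (simp add: Suc_leI)
  then have n2: "n \<ge> 2" using k by linarith
  define u where "u = ((\<chi> j. 1 / sqrt (real CARD('m))) :: real^'m)"
  note au = S_sph_inner[OF a, folded u_def]
  define q where "q = 1 / sqrt (real CARD('m))"
  have P: "hyp a t \<inter> {x. (\<Sum>j\<in>UNIV. x $ j) = 1} = {x. a \<bullet> x = t \<and> u \<bullet> x = q}"
    using au(4)[of _ 1] by (auto simp: hyp_def q_def)
  \<comment> \<open>The very isometry selected inside \<open>flat_vol\<close>;
    \<open>measure_double_cone\<close> applies to any such map.\<close>
  define f :: "real^'m \<Rightarrow> real^'k" where "f = (SOME f. (\<forall>x\<in>{x. a \<bullet> x = t \<and> u \<bullet> x = q}.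
       \<forall>y\<in>{x. a \<bullet> x = t \<and> u \<bullet> x = q}. dist (f x) (f y) = dist x y) \<and> f ` {x. a \<bullet> x = t \<and> u \<bullet> x = q} = UNIV)"
  have dim: "DIM(real^'m) = DIM(real^'k) + 2" using m k n2 by simp
  have f: "(\<forall>x\<in>{x. a \<bullet> x = t \<and> u \<bullet> x = q}. \<forall>y\<in>{x. a \<bullet> x = t \<and> u \<bullet> x = q}. dist (f x) (f y) = dist x y)
       \<and> f ` {x. a \<bullet> x = t \<and> u \<bullet> x = q} = UNIV"
    unfolding f_def by (rule someI_ex[OF exists_isometry_codim2_flat[OF dim au(1-3)]])
  let ?S = "hyp a t \<inter> std_simplex"
  have A: "sec_area TYPE('k) a t = measure lebesgue (f ` ?S)"
    unfolding sec_area_def flat_vol_def P f_def ..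
  have SP: "?S \<subseteq> {x. a \<bullet> x = t \<and> u \<bullet> x = q}"
    unfolding P[symmetric] by (auto simp: std_simplex_def)
  have "closed (hyp a t)" unfolding hyp_def by (rule closed_hyperplane)
  then have cS: "compact ?S" by (intro closed_Int_compact compact_std_simplex)
  have "(\<Sum>j\<in>UNIV. axis i (1::real) $ j) = 1" by (simp add: axis_def)
  then have ue: "u \<bullet> axis i 1 = q" using au(4) by (simp add: q_def)
  obtain k' where k': "k' \<noteq> i"
  proof -
    have "UNIV \<noteq> {i}" using m n2 by (metis card_1_singleton_iff One_nat_def Suc_eq_plus1 diff_Suc_1 not_numeral_le_zero)
    then show ?thesis using that by auto
  qed
  let ?N = "CARD('k)"
  have cone: "(\<lambda>((p,s),r). r *\<^sub>R (axis i 1 + s *\<^sub>R (p - axis i 1))) ` ((?S \<times> {0..1}) \<times> {0..1})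
      = sec_cone a t"
    by (rule sec_cone_eq_double_cone) (use ai aj k' in auto)
  \<comment> \<open>First evaluation of the volume, as a double cone of heights
    \<open>a $ i - t\<close> and \<open>q\<close>; the second comes from the sheared
    simplex.\<close>
  have "measure lebesgue (sec_cone a t) = q * (a $ i - t) * measure lebesgue (f ` ?S) / ((?N + 1) * (?N + 2))"
    using measure_double_cone[of a u t q f ?S "axis i 1" "a $ i - t"] dim au f SP cS ue ai
    unfolding cone by (simp add: inner_axis q_def)
  moreover have "measure lebesgue (sec_cone a t) =
           (\<Prod>j\<in>UNIV - {i}. (a $ i - t) / (a $ i - a $ j)) / fact CARD('m)"
    by (rule measure_sec_cone[where 'c = "(real^'k) \<times> real"]) (use m k n2 ai aj in auto)
  moreover have "(\<Prod>j\<in>UNIV - {i}. (a $ i - t) / (a $ i - a $ j)) = (a $ i - t) ^ n / (\<Prod>j\<in>UNIV - {i}. a $ i - a $ j)"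
    using m by (simp add: prod_dividef)
  moreover have "(a $ i - t) ^ n = (a $ i - t) * (a $ i - t) ^ (n - 1)"
    using n2 by (simp add: power_eq_if)
  ultimately have eq: "q * (a $ i - t) * sec_area TYPE('k) a t / ((?N + 1) * (?N + 2)) =
      (a $ i - t) * (a $ i - t) ^ (n - 1) / (\<Prod>j\<in>UNIV - {i}. a $ i - a $ j) / fact (n + 1)"
    using A m by simp
  define X where "X = (a $ i - t) ^ (n - 1) / (\<Prod>j\<in>UNIV - {i}. a $ i - a $ j)"
  have "fact (n + 1) = (real n + 1) * real n * fact (n - 1)"
    using n2 by (simp add: fact_reduce[of n] algebra_simps)
  moreover have "real ((?N + 1) * (?N + 2)) = real n * (real n + 1)" using k n2 by (simp add: algebra_simps)
  ultimately have "(a $ i - t) * (q * sec_area TYPE('k) a t / (real n * (real n + 1))) =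
      (a $ i - t) * (X / ((real n + 1) * real n * fact (n - 1)))"
    using eq by (simp add: X_def mult_ac)
  then have "q * sec_area TYPE('k) a t / (real n * (real n + 1)) = X / ((real n + 1) * real n * fact (n - 1))"
    using ai by (subst (asm) mult_left_cancel) auto
  also have "\<dots> = X / fact (n - 1) / (real n * (real n + 1))" by (simp add: mult_ac)
  finally have "q * sec_area TYPE('k) a t = X / fact (n - 1)"
    using n2 by (subst (asm) divide_cancel_right) auto
  then show ?thesis unfolding X_def[symmetric] using m by (simp add: q_def field_simps)
qed

subsection \<open>The extremal inequality\<close>

text \<open>For \<open>N * e \<le> 1\<close> this is AM-GM for \<open>N\<close> factors
  \<open>1 + e\<close> and one factor \<open>1 - N * e\<close>, of mean 1. It controls the deviation
  coefficient in the next induction.\<close>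

lemma linear_mult_power_le_one:
  fixes e :: real
  assumes "0 \<le> e"
  shows "(1 - real N * e) * (1 + e) ^ N \<le> 1"
proof (induction N)
  case (Suc N)
  have "(1 - real (Suc N) * e) * (1 + e) ^ Suc N =
      (1 - real N * e) * (1 + e) ^ N - real (Suc N) * e\<^sup>2 * (1 + e) ^ N"
    by (simp add: algebra_simps power2_eq_square)
  also have "\<dots> \<le> (1 - real N * e) * (1 + e) ^ N" using assms by simp
  finally show ?case using Suc by linarith
qed simp

text \<open>Induction on the number of factors: split off a factor \<open>w\<close> not above the mean. With
  \<open>w = y - N e\<close> the remaining factors have mean \<open>y + e\<close>, and the claim reduces to Bernoulli's inequality.\<close>

lemma prod_ge_mean_variance:
  fixes c :: "'i \<Rightarrow> real"
  assumes "finite A" "card A = N + 2" "\<And>j. j \<in> A \<Longrightarrow> 0 < c j" "(\<Sum>j\<in>A. c j) = real (N + 2) * y"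
  shows "y ^ N * (y\<^sup>2 - real (N + 1) / real (N + 2) * (\<Sum>j\<in>A. (c j - y)\<^sup>2)) \<le> (\<Prod>j\<in>A. c j)"
  using assms
proof (induction N arbitrary: A y)
  \<comment> \<open>For two factors the bound is the identity
    \<open>p q = y^2 - (p - q)^2 / 4\<close>.\<close>
  case 0
  then have "card A = 2" by simp
  then obtain p q where A: "A = {p, q}" "p \<noteq> q" by (auto simp: card_2_iff)
  have y: "y = (c p + c q) / 2" using 0 A by simp
  show ?case using A unfolding y by (simp add: power2_eq_square field_simps)
next
  case (Suc N)
  let ?n = "real (N + 3)"
  have ne: "A \<noteq> {}" using Suc.prems by auto
  have "\<exists>k\<in>A. c k \<le> y"
  proof (rule ccontr)
    assume "\<not> (\<exists>k\<in>A. c k \<le> y)"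
    then have "(\<Sum>j\<in>A. y) < (\<Sum>j\<in>A. c j)" using Suc.prems ne by (intro sum_strict_mono) auto
    then show False using Suc.prems by simp
  qed
  then obtain k where k: "k \<in> A" "c k \<le> y" by blast
  let ?B = "A - {k}"
  define e where "e = (y - c k) / real (N + 2)"
  have e: "0 \<le> e" "c k = y - real (N + 2) * e" using k by (auto simp: e_def)
  have B: "finite ?B" "card ?B = N + 2" using Suc.prems k by auto
  have sB: "(\<Sum>j\<in>?B. c j) = real (N + 2) * (y + e)"
  proof -
    have "(\<Sum>j\<in>?B. c j) = real (Suc N + 2) * y - c k"
      using Suc.prems k by (simp add: sum_diff1)
    then show ?thesis using e by (simp add: algebra_simps)
  qed
  define V where "V = (\<Sum>j\<in>?B. (c j - (y + e))\<^sup>2)"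
  have V0: "0 \<le> V" unfolding V_def by (intro sum_nonneg) auto
  have IH: "(y + e) ^ N * ((y + e)\<^sup>2 - real (N + 1) / real (N + 2) * V) \<le> (\<Prod>j\<in>?B. c j)"
    unfolding V_def by (rule Suc.IH) (use B sB Suc.prems in auto)
  have ck: "0 < c k" using Suc.prems k by auto
  have y: "0 < y" using ck k by simp
  \<comment> \<open>Moving the centre from \<open>y + e\<close> back to \<open>y\<close> costs
    \<open>(N + 2) * e^2\<close>, and the removed factor adds
    \<open>((N + 2) * e)^2\<close>.\<close>
  have VA: "(\<Sum>j\<in>A. (c j - y)\<^sup>2) = V + real (N + 2) * real (N + 3) * e\<^sup>2"
  proof -
    have "(\<Sum>j\<in>?B. (c j - y)\<^sup>2) = (\<Sum>j\<in>?B. (c j - (y + e))\<^sup>2 + 2 * e * (c j - (y + e)) + e\<^sup>2)"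
      by (rule sum.cong) (auto simp: power2_eq_square algebra_simps)
    also have "\<dots> = V + 2 * e * ((\<Sum>j\<in>?B. c j) - real (N + 2) * (y + e)) + real (N + 2) * e\<^sup>2"
      using B by (simp add: V_def sum.distrib sum_distrib_left[symmetric] sum_subtractf)
    finally have "(\<Sum>j\<in>?B. (c j - y)\<^sup>2) = V + real (N + 2) * e\<^sup>2" using sB by simp
    moreover have "(\<Sum>j\<in>A. (c j - y)\<^sup>2) = (c k - y)\<^sup>2 + (\<Sum>j\<in>?B. (c j - y)\<^sup>2)"
      using Suc.prems k by (subst sum.remove[of A k]) auto
    ultimately show ?thesis using e(2) by (simp add: power2_eq_square algebra_simps)
  qed
  define d where "d = e / y"
  have d: "0 \<le> d" "e = d * y" using e y by (auto simp: d_def)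
  have ck': "c k = y * (1 - real (N + 2) * d)" using e d by (simp add: algebra_simps)
  have pos: "0 \<le> 1 - real (N + 2) * d" using ck y unfolding ck' by (simp add: zero_less_mult_iff)
  have ye: "y + e = y * (1 + d)" using d by (simp add: algebra_simps)
  \<comment> \<open>The claim with all deviation within \<open>?B\<close> removed: divided by
    \<open>y ^ (N + 3)\<close>, it is Bernoulli times \<open>1 - (N + 2) * d\<close>.\<close>
  have main: "y ^ Suc N * (y\<^sup>2 - (real (N + 2))\<^sup>2 * e\<^sup>2) \<le> c k * (y + e) ^ (N + 2)"
  proof -
    have "1 + real (N + 2) * d \<le> (1 + d) ^ (N + 2)" using d by (intro Bernoulli_inequality) auto
    then have "(1 - real (N + 2) * d) * (1 + real (N + 2) * d) \<le> (1 - real (N + 2) * d) * (1 + d) ^ (N + 2)"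
      using pos by (rule mult_left_mono)
    then have "y ^ (N + 3) * ((1 - real (N + 2) * d) * (1 + real (N + 2) * d))
        \<le> y ^ (N + 3) * ((1 - real (N + 2) * d) * (1 + d) ^ (N + 2))"
      by (rule mult_left_mono) (use y in auto)
    moreover have "y ^ (N + 3) * ((1 - real (N + 2) * d) * (1 + real (N + 2) * d))
        = y ^ Suc N * (y\<^sup>2 - (real (N + 2))\<^sup>2 * e\<^sup>2)"
      unfolding d(2) by (simp add: power2_eq_square power_add power3_eq_cube algebra_simps)
    moreover have "y ^ (N + 3) * ((1 - real (N + 2) * d) * (1 + d) ^ (N + 2)) = c k * (y + e) ^ (N + 2)"
      unfolding ck' ye power_mult_distrib by (simp add: power_add power3_eq_cube power2_eq_square)
    ultimately show ?thesis by simp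
  qed
  \<comment> \<open>The weight that the induction hypothesis puts on \<open>V\<close> must not
    exceed the weight allowed by the claim.\<close>
  have coeff: "c k * (y + e) ^ N * (real (N + 1) / real (N + 2)) \<le> y ^ Suc N * (real (N + 2) / ?n)"
  proof (rule mult_mono)
    have "(1 - real (N + 2) * d) * (1 + d) ^ N \<le> (1 - real N * d) * (1 + d) ^ N"
      using d by (intro mult_right_mono) (auto simp: algebra_simps)
    also have "\<dots> \<le> 1" using d by (intro linear_mult_power_le_one)
    finally have "y ^ Suc N * ((1 - real (N + 2) * d) * (1 + d) ^ N) \<le> y ^ Suc N * 1"
      using y by (intro mult_left_mono) auto
    then show "c k * (y + e) ^ N \<le> y ^ Suc N"
      unfolding ck' ye power_mult_distrib by (simp add: algebra_simps)
  qed (use y in \<open>auto simp: field_simps\<close>)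
  have "y ^ Suc N * (y\<^sup>2 - real (Suc N + 1) / real (Suc N + 2) * (\<Sum>j\<in>A. (c j - y)\<^sup>2))
      = y ^ Suc N * (y\<^sup>2 - (real (N + 2))\<^sup>2 * e\<^sup>2) - y ^ Suc N * (real (N + 2) / ?n) * V"
    unfolding VA by (simp add: field_simps power2_eq_square)
  also have "\<dots> \<le> c k * (y + e) ^ (N + 2) - c k * (y + e) ^ N * (real (N + 1) / real (N + 2)) * V"
    using main mult_right_mono[OF coeff V0] by linarith
  also have "\<dots> = c k * ((y + e) ^ N * ((y + e)\<^sup>2 - real (N + 1) / real (N + 2) * V))"
    by (simp only: power_add right_diff_distrib mult.assoc)
  also have "\<dots> \<le> c k * (\<Prod>j\<in>?B. c j)"
    using IH ck by (intro mult_left_mono) auto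
  also have "\<dots> = (\<Prod>j\<in>A. c j)" using Suc.prems k by (simp add: prod.remove)
  finally show ?case .
qed

text \<open>Here \<open>y\<close> and \<open>\<tau>\<close> stand for the largest coordinate and the level in units of
  \<open>sqrt (n / (n + 1))\<close>, and \<open>T\<close> for the level of the midpoints of the edges.\<close>

lemma ratio_less_ge3:
  fixes \<tau> y T :: real
  assumes n: "3 \<le> n" and T: "T = sqrt ((real n - 1) / (2 * real n))"
    and \<tau>: "T < \<tau>" and y: "\<tau> < y" "y < 1"
  shows "((y - \<tau>) / (1 - \<tau>)) ^ (n - 1) < y ^ (n - 2) * ((y\<^sup>2 - T\<^sup>2) / (1 - T\<^sup>2))"
proof -
  have T12: "1 / 2 < T"
  proof -
    have "sqrt ((1/2)\<^sup>2) < T" unfolding T using n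
      by (intro real_sqrt_less_mono) (simp add: field_simps)
    then show ?thesis by simp
  qed
  have T1: "T < 1" using \<tau> y by simp
  \<comment> \<open>The left-hand ratio at \<open>\<tau> = T\<close>. The ratio decreases in
    \<open>\<tau>\<close>, so this is the worst level.\<close>
  define u where "u = (y - T) / (1 - T)"
  have "T * y \<le> T * 1" using T12 y by (intro mult_left_mono) auto
  then have u: "0 < u" "u \<le> y"
    using \<tau> y T1 by (auto simp: u_def divide_simps algebra_simps)
  have "(y - \<tau>) / (1 - \<tau>) < u"
  proof -
    have "(y - \<tau>) * (1 - T) < (y - T) * (1 - \<tau>)"
    proof -
      have "(y - T) * (1 - \<tau>) - (y - \<tau>) * (1 - T) = (\<tau> - T) * (1 - y)" by (simp add: algebra_simps)
      moreover have "0 < (\<tau> - T) * (1 - y)" using \<tau> y by simp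
      ultimately show ?thesis by linarith
    qed
    then show ?thesis using \<tau> y T1 by (simp add: u_def divide_simps)
  qed
  then have "((y - \<tau>) / (1 - \<tau>)) ^ (n - 1) < u ^ (n - 1)"
    using \<tau> y n by (intro power_strict_mono) auto
  \<comment> \<open>Here n \<ge> 3 enters: two factors \<open>u\<close> are compared with the
    quadratic, the others with \<open>y\<close>.\<close>
  also have "\<dots> = u ^ (n - 3) * (u * u)"
  proof -
    have "n - 1 = (n - 3) + 2" using n by simp
    then show ?thesis by (simp add: power_add power2_eq_square)
  qed
  also have "\<dots> \<le> y ^ (n - 3) * (y * ((y\<^sup>2 - T\<^sup>2) / (1 - T\<^sup>2)))"
  proof (rule mult_mono)
    show "u ^ (n - 3) \<le> y ^ (n - 3)" using u by (intro power_mono) auto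
    have "u \<le> y * ((y + T) / (1 + T))"
    proof -
      \<comment> \<open>Both sides agree at \<open>y = 1\<close>, so \<open>1 - y\<close> splits
        off; the cofactor is nonnegative because \<open>T > 1/2\<close>.\<close>
      have "(1 - T) * y * (y + T) - (1 + T) * (y - T) = (1 - y) * (T * (1 + T) - (1 - T) * y)"
        by (simp add: algebra_simps)
      moreover have "(1 - T) * y \<le> (1 - T) * 1" using T1 y by (intro mult_left_mono) auto
      moreover have "1 - T \<le> T * (1 + T)" 
        using T12 mult_mono[of "1/2" T "1/2" T] by (simp add: algebra_simps)
      ultimately have "0 \<le> (1 - T) * y * (y + T) - (1 + T) * (y - T)" using y by simp
      then show ?thesis using T1 T12 by (simp add: u_def divide_simps mult_ac)
    qed
    then have "u * u \<le> u * (y * ((y + T) / (1 + T)))" using u by (intro mult_left_mono) auto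
    also have "\<dots> = y * ((y\<^sup>2 - T\<^sup>2) / (1 - T\<^sup>2))"
    proof -
      have "1 - T\<^sup>2 = (1 - T) * (1 + T)" "y\<^sup>2 - T\<^sup>2 = (y - T) * (y + T)"
        by (simp_all add: power2_eq_square algebra_simps)
      then show ?thesis by (simp add: u_def)
    qed
    finally show "u * u \<le> y * ((y\<^sup>2 - T\<^sup>2) / (1 - T\<^sup>2))" .
  qed (use u y in auto)
  also have "\<dots> = y ^ (n - 2) * ((y\<^sup>2 - T\<^sup>2) / (1 - T\<^sup>2))"
  proof -
    have "n - 2 = Suc (n - 3)" using n by simp
    then show ?thesis by simp
  qed
  finally show ?thesis .
qed

text \<open>Both expressions equal 1 at \<open>y = 1\<close>; after splitting off
  \<open>1 - y\<close> the comparison is linear in \<open>y\<close>. The first equivalence serves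
  maximality, the second the counterexample.\<close>

lemma ratio_compare_2:
  fixes \<tau> y :: real
  assumes "\<tau> < 1" "y < 1"
  shows "(y - \<tau>) / (1 - \<tau>) < (4 * y\<^sup>2 - 1) / 3 \<longleftrightarrow> 4 * (1 - \<tau>) * y < 4 * \<tau> - 1"
    and "(4 * y\<^sup>2 - 1) / 3 < (y - \<tau>) / (1 - \<tau>) \<longleftrightarrow> 4 * \<tau> - 1 < 4 * (1 - \<tau>) * y"
proof -
  have eq: "(4 * y\<^sup>2 - 1) / 3 - (y - \<tau>) / (1 - \<tau>) =
      (1 - y) / (3 * (1 - \<tau>)) * (4 * \<tau> - 1 - 4 * (1 - \<tau>) * y)"
    using assms by (simp add: field_simps power2_eq_square)
  have pos: "0 < (1 - y) / (3 * (1 - \<tau>))" using assms by simp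
  show "(y - \<tau>) / (1 - \<tau>) < (4 * y\<^sup>2 - 1) / 3 \<longleftrightarrow> 4 * (1 - \<tau>) * y < 4 * \<tau> - 1"
    using eq zero_less_mult_pos[OF _ pos] mult_pos_pos[OF pos] by (smt (verit))
  show "(4 * y\<^sup>2 - 1) / 3 < (y - \<tau>) / (1 - \<tau>) \<longleftrightarrow> 4 * \<tau> - 1 < 4 * (1 - \<tau>) * y"
    using eq mult_less_0_iff[of "(1 - y) / (3 * (1 - \<tau>))"] pos by (smt (verit))
qed

text \<open>The right side is
  \<open>y ^ (n - 2) * (y\<^sup>2 - T\<^sup>2) / (1 - T\<^sup>2)\<close>, written as the product
  bound delivers it. For n = 2 it is \<open>(4 * y\<^sup>2 - 1) / 3\<close>.\<close>

lemma ratio_less: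
  fixes \<tau> y :: real
  assumes "(3 \<le> n \<and> sqrt ((real n - 1) / (2 * real n)) < \<tau>) \<or> (n = 2 \<and> 5 / 8 \<le> \<tau>)"
    and y: "\<tau> < y" "y < 1"
  shows "((y - \<tau>) / (1 - \<tau>)) ^ (n - 1)
      < y ^ (n - 2) * (y\<^sup>2 - real (n - 1) / real n * (real n / (real n + 1) * (1 - y\<^sup>2)))"
  using assms(1)
proof (elim disjE conjE)
  assume n: "3 \<le> n" and \<tau>: "sqrt ((real n - 1) / (2 * real n)) < \<tau>"
  define T where "T = sqrt ((real n - 1) / (2 * real n))"
  have T2: "T\<^sup>2 = (real n - 1) / (2 * real n)" using n by (simp add: T_def)
  moreover have "1 - T\<^sup>2 = (real n + 1) / (2 * real n)" using n unfolding T2 by (simp add: field_simps)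
  moreover have "(Y - (real n - 1) / (2 * real n)) / ((real n + 1) / (2 * real n))
      = Y - real (n - 1) / real n * (real n / (real n + 1) * (1 - Y))" for Y
    using n by (simp add: of_nat_diff divide_simps) (simp add: algebra_simps)
  ultimately have "(y\<^sup>2 - T\<^sup>2) / (1 - T\<^sup>2) = y\<^sup>2 - real (n - 1) / real n * (real n / (real n + 1) * (1 - y\<^sup>2))"
    by simp
  then show ?thesis using ratio_less_ge3[OF n T_def, of \<tau> y] \<tau> y by (simp add: T_def)
next
  assume n: "n = 2" and \<tau>: "5 / 8 \<le> \<tau>"
  have "4 * (1 - \<tau>) * y < 4 * (1 - \<tau>) * 1" using y by (intro mult_strict_left_mono) auto
  then have "4 * (1 - \<tau>) * y < 4 * \<tau> - 1" using \<tau> by simp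
  then have "(y - \<tau>) / (1 - \<tau>) < (4 * y\<^sup>2 - 1) / 3" using ratio_compare_2 y by simp
  also have "(4 * y\<^sup>2 - 1) / 3 = y\<^sup>2 - 1 / 2 * (2 / 3 * (1 - y\<^sup>2))" by (simp add: field_simps)
  finally show ?thesis using n by simp
qed

subsection \<open>Comparison with the extremal section\<close>

text \<open>If two coordinates have mean \<open>b\<close>, the other \<open>n - 1\<close> sum to
  \<open>- 2 * b\<close>, and Cauchy-Schwarz with the unit norm gives
  \<open>2 * b^2 + 4 * b^2 / (n - 1) \<le> 1\<close>.\<close>

lemma S_sph_not_two_large:
  fixes a :: "real^'m" and i j :: 'm
  assumes m: "CARD('m) = n + 1" and n: "2 \<le> n" and a: "a \<in> S_sph"
    and t: "sqrt ((real n - 1) / (2 * (real n + 1))) < t" and ij: "i \<noteq> j"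
  shows "a $ i < t \<or> a $ j < t"
proof (rule ccontr)
  assume "\<not> (a $ i < t \<or> a $ j < t)"
  then have ge: "t \<le> a $ i" "t \<le> a $ j" by auto
  define b where "b = (a $ i + a $ j) / 2"
  have bt: "t \<le> b" using ge by (simp add: b_def)
  let ?R = "UNIV - {i} - {j}"
  have split: "(\<Sum>k\<in>UNIV. f k) = f i + (f j + (\<Sum>k\<in>?R. f k))" for f :: "'m \<Rightarrow> real"
    using ij by (subst sum.remove[of _ i], simp, simp, subst sum.remove[of _ j]) auto
  have "(\<Sum>k\<in>UNIV. a $ k) = 0" "norm a = 1" using a by (auto simp: S_sph_def)
  then have s: "(\<Sum>k\<in>?R. a $ k) = - 2 * b" "(a $ i)\<^sup>2 + (a $ j)\<^sup>2 + (\<Sum>k\<in>?R. (a $ k)\<^sup>2) = 1"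
    unfolding split b_def by (auto simp: norm_eq_1 inner_vec_def split power2_eq_square)
  have cR: "real (card ?R) = real n - 1" using m n ij by simp
  have "(\<Sum>k\<in>?R. a $ k)\<^sup>2 \<le> (\<Sum>k\<in>?R. (a $ k)\<^sup>2) * real (card ?R)"
    by (rule sum_squared_le_sum_of_squares) 
  then have 1: "4 * b\<^sup>2 \<le> (real n - 1) * (\<Sum>k\<in>?R. (a $ k)\<^sup>2)"
    unfolding s cR by (simp add: power_mult_distrib mult.commute)
  have "2 * b\<^sup>2 \<le> (a $ i)\<^sup>2 + (a $ j)\<^sup>2"
    using sum_squares_bound[of "a $ i" "a $ j"] by (simp add: b_def power2_eq_square field_simps)
  then have "(real n - 1) * (2 * b\<^sup>2) \<le> (real n - 1) * ((a $ i)\<^sup>2 + (a $ j)\<^sup>2)"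
    using n by (intro mult_left_mono) auto
  with 1 have "(real n - 1) * (2 * b\<^sup>2) + 4 * b\<^sup>2 \<le>
      (real n - 1) * ((a $ i)\<^sup>2 + (a $ j)\<^sup>2 + (\<Sum>k\<in>?R. (a $ k)\<^sup>2))"
    by (simp add: algebra_simps)
  then have "b\<^sup>2 \<le> (real n - 1) / (2 * (real n + 1))"
    unfolding s by (simp add: field_simps)
  then have "b \<le> sqrt ((real n - 1) / (2 * (real n + 1)))" by (rule real_le_rsqrt)
  then show False using t bt by simp
qed

text \<open>The hyperplane at most touches the simplex, in the face spanned by the vertices at level
  exactly \<open>t\<close>: one vertex or none. Its image is null under any map.\<close>

lemma sec_area_eq_0:
  fixes a :: "real^'m"
  assumes le: "\<And>j. a $ j \<le> t" and two: "\<And>i j. i \<noteq> j \<Longrightarrow> a $ i < t \<or> a $ j < t"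
  shows "sec_area TYPE('k::finite) a t = 0"
proof -
  have "hyp a t \<inter> std_simplex \<subseteq> range (\<lambda>i. axis i 1)"
  proof
    fix x assume "x \<in> hyp a t \<inter> std_simplex"
    then have x: "a \<bullet> x = t" "\<And>j. 0 \<le> x $ j" "(\<Sum>j\<in>UNIV. x $ j) = 1"
      by (auto simp: hyp_def std_simplex_def)
    have nn: "0 \<le> (t - a $ j) * x $ j" for j using le[of j] x(2)[of j] by simp
    have "(\<Sum>j\<in>UNIV. (t - a $ j) * x $ j) = 0"
      using x(1,3) by (simp add: inner_vec_def left_diff_distrib sum_subtractf sum_distrib_left[symmetric])
    then have "(t - a $ j) * x $ j = 0" for j using nn by (simp add: sum_nonneg_eq_0_iff)
    then have z: "x $ j = 0" if "a $ j < t" for j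
      using that by (metis less_irrefl mult_eq_0_iff right_minus_eq)
    have "\<exists>i. x $ i \<noteq> 0" using x(3) by (metis sum.neutral zero_neq_one)
    then obtain i where i: "x $ i \<noteq> 0" by blast
    then have xj: "x $ j = 0" if "j \<noteq> i" for j using z two[OF that] by blast
    then have "x $ i = 1" using x(3) by (simp add: sum.remove[of UNIV i])
    with xj have "x = axis i 1" by (simp add: vec_eq_iff axis_def)
    then show "x \<in> range (\<lambda>i. axis i 1)" by blast
  qed
  then have "finite (hyp a t \<inter> std_simplex)" by (rule finite_subset) simp
  then have "negligible (f ` (hyp a t \<inter> std_simplex))" for f :: "real^'m \<Rightarrow> real^'k"
    by (intro negligible_finite finite_imageI)
  then show ?thesis unfolding sec_area_def flat_vol_def
    by (intro negligible_imp_measure0)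
qed

text \<open>In the form \<open>X - 1 / X\<close> of the small entries, all gaps to the large entry
  are visibly \<open>1 / X\<close>.\<close>

lemma a_star_nth:
  fixes i :: "'m::finite"
  assumes "CARD('m) = n + 1" "2 \<le> n"
  defines "X \<equiv> sqrt (real n / (real n + 1))"
  shows "0 < X" "X\<^sup>2 = real n / (real n + 1)" "a_star i $ j = (if j = i then X else X - 1 / X)"
proof -
  show X: "0 < X" "X\<^sup>2 = real n / (real n + 1)" using assms by (auto simp: X_def)
  have "- 1 / sqrt (real n * (real n + 1)) = X - 1 / X"
  proof -
    define r where "r = sqrt (real n)"
    define s where "s = sqrt (real n + 1)"
    have rs: "0 < r" "0 < s" "r\<^sup>2 - s\<^sup>2 = - 1" using assms by (auto simp: r_def s_def)
    have Xr: "X = r / s" by (simp add: X_def r_def s_def real_sqrt_divide)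
    have "X - 1 / X = (r\<^sup>2 - s\<^sup>2) / (r * s)"
      unfolding Xr using rs(1,2) by (simp add: divide_simps power2_eq_square)
    also have "r * s = sqrt (real n * (real n + 1))" by (simp add: r_def s_def real_sqrt_mult)
    finally show ?thesis by (simp add: rs(3))
  qed
  then show "a_star i $ j = (if j = i then X else X - 1 / X)"
    using assms(1) by (simp add: a_star_def X_def add.commute)
qed

lemma a_star_in_S_sph:
  fixes i :: "'m::finite"
  assumes "CARD('m) = n + 1" "2 \<le> n"
  shows "a_star i \<in> S_sph"
proof -
  define X where "X = sqrt (real n / (real n + 1))"
  note X = a_star_nth[OF assms, folded X_def]
  have split: "(\<Sum>k\<in>UNIV. f k) = f i + (\<Sum>k\<in>UNIV - {i}. f k)" for f :: "'m \<Rightarrow> real"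
    by (subst sum.remove[of _ i]) auto
  have n1: "X\<^sup>2 * (real n + 1) = real n" unfolding X(2) by simp
  have "(\<Sum>k\<in>UNIV. a_star i $ k) = X + real n * (X - 1 / X)"
    unfolding split using assms by (simp add: X(3))
  also have "\<dots> = (X\<^sup>2 * (real n + 1) - real n) / X"
    using X(1) by (simp add: field_simps power2_eq_square)
  finally have 1: "(\<Sum>k\<in>UNIV. a_star i $ k) = 0" using n1 by simp
  have "a_star i \<bullet> a_star i = X * X + real n * ((X - 1 / X) * (X - 1 / X))"
    unfolding inner_vec_def split using assms by (simp add: X(3))
  also have "\<dots> = (X\<^sup>2 * (X\<^sup>2 * (real n + 1)) - 2 * real n * X\<^sup>2 + real n) / X\<^sup>2"
    using X(1) by (simp add: field_simps power2_eq_square)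
  also have "\<dots> = real n * (1 - X\<^sup>2) / X\<^sup>2" unfolding n1 by (simp add: algebra_simps)
  also have "\<dots> = 1" unfolding X(2) using assms by (simp add: field_simps)
  finally show ?thesis using 1 by (simp add: S_sph_def norm_eq_1)
qed

lemma sec_area_a_star:
  fixes i :: "'m::finite"
  assumes m: "CARD('m) = n + 1" and k: "CARD('k::finite) = n - 1" and n: "2 \<le> n"
    and t: "0 < t" "t \<le> sqrt (real n / (real n + 1))"
  shows "sec_area TYPE('k) (a_star i) t =
      sqrt (real n + 1) / fact (n - 1) * ((sqrt (real n / (real n + 1))) ^ n * (sqrt (real n / (real n + 1)) - t) ^ (n - 1))"
proof -
  define X where "X = sqrt (real n / (real n + 1))"
  note X = a_star_nth[OF m n, folded X_def]
  have "X < 1" unfolding X_def by simp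
  then have "X * X < 1 * 1" using X(1) by (intro mult_strict_mono) auto
  then have neg: "X - 1 / X < 0" using X(1) by (simp add: field_simps)
  show ?thesis
  proof (cases "t < X")
    case True
    have "sec_area TYPE('k) (a_star i) t = sqrt (real n + 1) / fact (n - 1) *
       ((a_star i $ i - t) ^ (n - 1) / (\<Prod>j\<in>UNIV - {i}. a_star i $ i - a_star i $ j))"
      by (rule sec_area_eq[OF m k a_star_in_S_sph[OF m n]]) (use True X(3) neg t in auto)
    also have "(\<Prod>j\<in>UNIV - {i}. a_star i $ i - a_star i $ j) = (\<Prod>j\<in>UNIV - {i}. 1 / X)"
      by (rule prod.cong) (auto simp: X(3))
    also have "\<dots> = (1 / X) ^ n" using m by simp
    finally show ?thesis unfolding X_def[symmetric] by (simp add: X(3) power_one_over field_simps)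
  next
    case False
    \<comment> \<open>The hyperplane passes through the vertex, so \<open>sec_area_eq\<close> does
      not apply; both sides are 0 because \<open>n - 1 > 0\<close>.\<close>
    then have "t = X" using t by (simp add: X_def)
    moreover have "sec_area TYPE('k) (a_star i) t = 0"
      by (rule sec_area_eq_0) (use X(3) neg t \<open>t = X\<close> in auto)
    ultimately show ?thesis using n by (simp add: X_def[symmetric])
  qed
qed

text \<open>The two equations defining \<open>S_sph\<close> fix the mean and the squared deviations
  of the rescaled gaps \<open>c j\<close>. The deviations force \<open>y \<le> 1\<close>, and at
  \<open>y = 1\<close> they vanish, making all gaps equal.\<close>

lemma S_sph_prod_bound:
  fixes a :: "real^'m" and i :: 'm
  assumes m: "CARD('m) = n + 1" and n: "2 \<le> n" and a: "a \<in> S_sph" and pos: "\<And>j. j \<noteq> i \<Longrightarrow> a $ j < a $ i"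
  defines "X \<equiv> sqrt (real n / (real n + 1))"
  defines "y \<equiv> a $ i / X"
  shows "y ^ (n - 2) * (y\<^sup>2 - real (n - 1) / real n * (real n / (real n + 1) * (1 - y\<^sup>2)))
            \<le> X ^ n * (\<Prod>j\<in>UNIV - {i}. a $ i - a $ j)"
    and "y \<le> 1" and "y = 1 \<Longrightarrow> a = a_star i"
proof -
  note X = a_star_nth[OF m n, folded X_def]
  have n1: "X\<^sup>2 * (real n + 1) = real n" unfolding X(2) by simp
  have ai: "a $ i = X * y" using X(1) by (simp add: y_def)
  let ?A = "UNIV - {i}"
  have cA: "card ?A = n" using m by simp
  have split: "(\<Sum>k\<in>?A. f k) = (\<Sum>k\<in>UNIV. f k) - f i" for f :: "'m \<Rightarrow> real"
    by (subst (2) sum.remove[of _ i]) auto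
  have "(\<Sum>k\<in>UNIV. a $ k) = 0" "norm a = 1" using a by (auto simp: S_sph_def)
  then have s: "(\<Sum>k\<in>?A. a $ k) = - a $ i" "(\<Sum>k\<in>?A. (a $ k)\<^sup>2) = 1 - (a $ i)\<^sup>2"
    unfolding split by (auto simp: norm_eq_1 inner_vec_def power2_eq_square)
  define c where "c j = X * (a $ i - a $ j)" for j
  have cpos: "0 < c j" if "j \<in> ?A" for j using that pos X(1) by (simp add: c_def)
  have "(\<Sum>j\<in>?A. c j) = X * (real n * a $ i + a $ i)"
    unfolding c_def sum_distrib_left[symmetric] using cA s by (simp add: sum_subtractf)
  also have "\<dots> = (X\<^sup>2 * (real n + 1)) * y" unfolding ai by (simp add: power2_eq_square algebra_simps)
  finally have sc: "(\<Sum>j\<in>?A. c j) = real n * y" unfolding n1 .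
  have "(\<Sum>j\<in>?A. (c j)\<^sup>2) = X\<^sup>2 * (\<Sum>j\<in>?A. (a $ i)\<^sup>2 - 2 * a $ i * a $ j + (a $ j)\<^sup>2)"
    unfolding sum_distrib_left by (rule sum.cong) (auto simp: c_def power2_eq_square algebra_simps)
  also have "(\<Sum>j\<in>?A. (a $ i)\<^sup>2 - 2 * a $ i * a $ j + (a $ j)\<^sup>2)
      = real n * (a $ i)\<^sup>2 - 2 * a $ i * (\<Sum>j\<in>?A. a $ j) + (\<Sum>j\<in>?A. (a $ j)\<^sup>2)"
    using cA by (simp add: sum.distrib sum_subtractf sum_distrib_left)
  also have "X\<^sup>2 * \<dots> = X\<^sup>2 * ((real n + 1) * (a $ i)\<^sup>2 + 1)"
    unfolding s by (simp add: power2_eq_square algebra_simps)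
  also have "\<dots> = (X\<^sup>2 * (real n + 1)) * X\<^sup>2 * y\<^sup>2 + X\<^sup>2"
    unfolding ai by (simp add: power2_eq_square algebra_simps)
  finally have sc2: "(\<Sum>j\<in>?A. (c j)\<^sup>2) = real n * X\<^sup>2 * y\<^sup>2 + X\<^sup>2" unfolding n1 .
  have "(\<Sum>j\<in>?A. (c j - y)\<^sup>2) = (\<Sum>j\<in>?A. (c j)\<^sup>2 - 2 * y * c j + y\<^sup>2)"
    by (rule sum.cong) (auto simp: power2_eq_square algebra_simps)
  also have "\<dots> = real n * X\<^sup>2 * y\<^sup>2 + X\<^sup>2 - real n * y\<^sup>2"
    using cA by (simp add: sum.distrib sum_subtractf sum_distrib_left[symmetric] sc sc2) (simp add: power2_eq_square)
  also have "real n * X\<^sup>2 = real n - X\<^sup>2" using n1 by (simp add: algebra_simps)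
  also have "(real n - X\<^sup>2) * y\<^sup>2 + X\<^sup>2 - real n * y\<^sup>2 = X\<^sup>2 * (1 - y\<^sup>2)"
    by (simp add: algebra_simps)
  also have "\<dots> = real n / (real n + 1) * (1 - y\<^sup>2)" unfolding X(2) ..
  finally have V: "(\<Sum>j\<in>?A. (c j - y)\<^sup>2) = real n / (real n + 1) * (1 - y\<^sup>2)" .
  have n_eq: "n - 2 + 2 = n" "n - 2 + 1 = n - 1" using n by auto
  have "y ^ (n - 2) * (y\<^sup>2 - real (n - 2 + 1) / real (n - 2 + 2) * (\<Sum>j\<in>?A. (c j - y)\<^sup>2)) \<le> (\<Prod>j\<in>?A. c j)"
    by (rule prod_ge_mean_variance) (use cA n cpos sc in auto)
  also have "(\<Prod>j\<in>?A. c j) = X ^ n * (\<Prod>j\<in>?A. a $ i - a $ j)"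
    using cA by (simp add: c_def prod.distrib)
  finally show "y ^ (n - 2) * (y\<^sup>2 - real (n - 1) / real n * (real n / (real n + 1) * (1 - y\<^sup>2)))
            \<le> X ^ n * (\<Prod>j\<in>UNIV - {i}. a $ i - a $ j)" unfolding V n_eq .
  have "0 \<le> real n / (real n + 1) * (1 - y\<^sup>2)" unfolding V[symmetric] by (intro sum_nonneg) auto
  moreover have "0 < real n / (real n + 1)" using n by simp
  ultimately have "y\<^sup>2 \<le> 1" by (simp only: zero_le_mult_iff) linarith
  then show "y \<le> 1" using abs_square_le_1 by (auto simp: abs_le_iff)
  assume "y = 1"
  then have "(\<Sum>j\<in>?A. (c j - 1)\<^sup>2) = 0" using V by simp
  then have c1: "c j = 1" if "j \<noteq> i" for j using that by (simp add: sum_nonneg_eq_0_iff)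
  have "a $ j = a_star i $ j" for j
  proof (cases "j = i")
    case True then show ?thesis using ai \<open>y = 1\<close> X(3) by simp
  next
    case False
    then have "X - a $ j = 1 / X" using c1[OF False] X(1) ai \<open>y = 1\<close> by (simp add: c_def field_simps)
    then show ?thesis using False X(3) by simp
  qed
  then show "a = a_star i" by (simp add: vec_eq_iff)
qed

lemma sec_area_less_a_star:
  fixes a :: "real^'m" and i :: 'm
  assumes m: "CARD('m) = n + 1" and k: "CARD('k::finite) = n - 1" and n: "2 \<le> n" and a: "a \<in> S_sph"
  defines "X \<equiv> sqrt (real n / (real n + 1))"
  assumes t: "sqrt ((real n - 1) / (2 * (real n + 1))) < t" "t < X" "3 \<le> n \<or> 5 / 8 * X \<le> t"
    and neq: "\<And>j. a \<noteq> a_star j"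
  shows "sec_area TYPE('k) a t < sec_area TYPE('k) (a_star i) t"
proof -
  note X = a_star_nth[OF m n, folded X_def]
  have t0: "0 < t" using t(1) n by (intro le_less_trans[OF real_sqrt_ge_zero t(1)]) auto
  note star = sec_area_a_star[OF m k n t0, folded X_def, OF less_imp_le[OF t(2)]]
  note two = S_sph_not_two_large[OF m n a t(1)]
  let ?C = "sqrt (real n + 1) / fact (n - 1)"
  have C: "0 < ?C" by (simp add: add_pos_nonneg)
  show ?thesis
  proof (cases "\<exists>l. t < a $ l")
    case False
    then have "sec_area TYPE('k) a t = 0" by (intro sec_area_eq_0 two) (auto simp: not_less)
    moreover have "0 < ?C * (X ^ n * (X - t) ^ (n - 1))" using C X(1) t(2) by simp
    ultimately show ?thesis using star by simp
  next
    case True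
    then obtain l where l: "t < a $ l" by blast
    have lj: "a $ j < t" if "j \<noteq> l" for j using two[OF that] l by auto
    define P where "P = (\<Prod>j\<in>UNIV - {l}. a $ l - a $ j)"
    have P: "0 < P" unfolding P_def using l lj by (intro prod_pos) (auto intro: less_trans)
    have area: "sec_area TYPE('k) a t = ?C * ((a $ l - t) ^ (n - 1) / P)"
      unfolding P_def by (rule sec_area_eq[OF m k a l lj])
    define y where "y = a $ l / X"
    define \<tau> where "\<tau> = t / X"
    note bound = S_sph_prod_bound[OF m n a, of l, folded X_def, folded y_def P_def]
    have jl: "a $ j < a $ l" if "j \<noteq> l" for j using lj[OF that] l by simp
    have b1: "y ^ (n - 2) * (y\<^sup>2 - real (n - 1) / real n * (real n / (real n + 1) * (1 - y\<^sup>2))) \<le> X ^ n * P"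
      by (rule bound(1)) (rule jl)
    have "y \<le> 1" by (rule bound(2)) (rule jl)
    moreover have "y \<noteq> 1" using bound(3) jl neq by blast
    ultimately have y: "\<tau> < y" "y < 1" using l X(1) by (auto simp: y_def \<tau>_def divide_strict_right_mono)
    have \<tau>: "(3 \<le> n \<and> sqrt ((real n - 1) / (2 * real n)) < \<tau>) \<or> (n = 2 \<and> 5 / 8 \<le> \<tau>)"
    proof (cases "3 \<le> n")
      case True
      have "sqrt ((real n - 1) / (2 * real n)) * X = sqrt ((real n - 1) / (2 * (real n + 1)))"
        unfolding X_def real_sqrt_mult[symmetric] using n by simp
      then show ?thesis using True t(1) X(1) by (simp add: \<tau>_def pos_less_divide_eq)
    next
      case False
      then show ?thesis using t(3) n X(1) by (simp add: \<tau>_def pos_le_divide_eq)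
    qed
    \<comment> \<open>The ratio does not change when levels are measured in units of
      \<open>X\<close>; this is the desired comparison of areas with denominators cleared.\<close>
    have "((y - \<tau>) / (1 - \<tau>)) ^ (n - 1) < X ^ n * P"
      using ratio_less[OF \<tau> y] b1 by linarith
    moreover have "(y - \<tau>) / (1 - \<tau>) = (a $ l - t) / (X - t)"
      using X(1) t(2) by (simp add: y_def \<tau>_def divide_simps)
    ultimately have "(a $ l - t) ^ (n - 1) / P < X ^ n * (X - t) ^ (n - 1)"
      using P t(2) by (simp add: power_divide divide_simps mult_ac)
    then show ?thesis unfolding star area using C by (rule mult_strict_left_mono)
  qed
qed

section \<open>The planar counterexample\<close>

text \<open>For n = 2 the area is an exact function of the largest coordinate, and below level 5/8
  it exceeds the value at \<open>a_star\<close> once that coordinate is close enough to its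
  maximum.\<close>

lemma sec_area_exceeds_a_star_2:
  fixes i :: "'m::finite"
  assumes m: "CARD('m) = 3" and k: "CARD('k::finite) = 1"
    and t: "1 / sqrt 6 < t" "t < 5 / 4 * (1 / sqrt 6)"
  shows "\<exists>a::real^'m\<in>S_sph. sec_area TYPE('k) (a_star i) t < sec_area TYPE('k) a t"
proof -
  have m': "CARD('m) = 2 + 1" and k': "CARD('k) = 2 - 1" using m k by auto
  define X :: real where "X = sqrt (2 / 3)"
  have X: "0 < X" "X\<^sup>2 = 2 / 3" by (auto simp: X_def)
  have X6: "X = 2 * (1 / sqrt 6)"
  proof -
    have "sqrt 6 * sqrt (2 / 3) = sqrt (2\<^sup>2)" unfolding real_sqrt_mult[symmetric] by simp
    then show ?thesis by (simp add: X_def field_simps)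
  qed
  define \<tau> where "\<tau> = t / X"
  have "1 / 2 * X < t" "t < 5 / 8 * X" using t X6 by auto
  then have \<tau>: "1 / 2 < \<tau>" "\<tau> < 5 / 8"
    using X(1) by (auto simp: \<tau>_def pos_less_divide_eq pos_divide_less_eq)
  have "max \<tau> ((4 * \<tau> - 1) / (4 * (1 - \<tau>))) < 1" using \<tau> by (simp add: field_simps)
  \<comment> \<open>The second bound is the linear condition of \<open>ratio_compare_2\<close>
    solved for \<open>y\<close>; it is below 1 exactly when \<open>\<tau> < 5 / 8\<close>.\<close>
  then obtain y where "max \<tau> ((4 * \<tau> - 1) / (4 * (1 - \<tau>))) < y" and y1: "y < 1" using dense by blast
  then have y: "\<tau> < y" "4 * \<tau> - 1 < 4 * (1 - \<tau>) * y" using \<tau> by (auto simp: field_simps)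
  have ratio: "(4 * y\<^sup>2 - 1) / 3 < (y - \<tau>) / (1 - \<tau>)" using ratio_compare_2(2)[of \<tau> y] y y1 \<tau> by simp
  define d where "d = sqrt ((1 - y\<^sup>2) / 3)"
  have yy: "1 / 4 < y\<^sup>2" "y\<^sup>2 < 1"
    using y y1 \<tau> power_strict_mono[of "1/2" y 2] power_strict_mono[of y 1 2] by (auto simp: power2_eq_square)
  have d: "d\<^sup>2 = (1 - y\<^sup>2) / 3" using yy by (simp add: d_def)
  have "card (UNIV - {i}) = 2" using m by simp
  then obtain j l where jl: "UNIV - {i} = {j, l}" "j \<noteq> l" by (meson card_2_iff)
  then have ij: "j \<noteq> i" "l \<noteq> i" by auto
  have U: "UNIV = {i, j, l}" using jl by auto
  \<comment> \<open>Coordinate sum 0 centres the other two entries at \<open>- X * y / 2\<close>.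
    The factor 3/2 makes the rescaled gaps \<open>y + d\<close> and \<open>y - d\<close>, and unit
    norm determines \<open>d\<close>.\<close>
  define a :: "real^'m" where
    "a = (\<chi> h. X * (if h = i then y else if h = j then - y / 2 - 3 / 2 * d else - y / 2 + 3 / 2 * d))"
  have aa: "a $ i = X * y" "a $ j = X * (- y / 2 - 3 / 2 * d)" "a $ l = X * (- y / 2 + 3 / 2 * d)"
    using ij jl(2) by (auto simp: a_def)
  have "(\<Sum>h\<in>UNIV. a $ h) = 0"
    unfolding U using ij jl(2) by (simp add: aa algebra_simps)
  moreover have "a \<bullet> a = X\<^sup>2 * (3 / 2 * y\<^sup>2 + 9 / 2 * d\<^sup>2)"
    unfolding inner_vec_def U using ij jl(2) by (simp add: aa power2_eq_square algebra_simps)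
  moreover have "X\<^sup>2 * (3 / 2 * y\<^sup>2 + 9 / 2 * d\<^sup>2) = 1" unfolding X(2) d by (simp add: field_simps)
  ultimately have a: "a \<in> S_sph" by (simp add: S_sph_def norm_eq_1)
  have t': "sqrt ((real 2 - 1) / (2 * (real 2 + 1))) < t" using t by (simp add: real_sqrt_divide)
  have ai: "t < a $ i" using y X(1) by (simp add: aa \<tau>_def field_simps)
  have aj: "a $ h < t" if "h \<noteq> i" for h
    using S_sph_not_two_large[OF m' _ a t' that] ai by auto
  have "sec_area TYPE('k) a t = sqrt (real 2 + 1) / fact (2 - 1) *
      ((a $ i - t) ^ (2 - 1) / (\<Prod>h\<in>UNIV - {i}. a $ i - a $ h))"
    by (rule sec_area_eq[OF m' k' a ai aj])
  also have "(\<Prod>h\<in>UNIV - {i}. a $ i - a $ h) = X\<^sup>2 * (9 / 4 * (y\<^sup>2 - d\<^sup>2))"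
    unfolding jl(1) using jl(2) by (simp add: aa power2_eq_square algebra_simps)
  also have "\<dots> = 3 / 2 * ((4 * y\<^sup>2 - 1) / 3)" unfolding X(2) d by (simp add: field_simps)
  finally have area: "sec_area TYPE('k) a t = sqrt 3 * (X * (y - \<tau>) / (3 / 2 * ((4 * y\<^sup>2 - 1) / 3)))"
    using X(1) by (simp add: aa \<tau>_def right_diff_distrib)
  have tX: "0 < t" "t \<le> sqrt (real 2 / (real 2 + 1))"
    using t X6 X(1) less_trans[of 0 "1 / sqrt 6" t] by (auto simp: X_def)
  have X\<tau>: "X * (1 - \<tau>) = X - t" using X(1) by (simp add: \<tau>_def right_diff_distrib)
  have star: "sec_area TYPE('k) (a_star i) t = sqrt 3 * (X * (1 - \<tau>) / (3 / 2))"
    unfolding X\<tau> using sec_area_a_star[OF m' k' _ tX, of i] X by (simp add: X_def[symmetric] field_simps)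
  have "1 - \<tau> < (y - \<tau>) / ((4 * y\<^sup>2 - 1) / 3)"
    using ratio yy \<tau> by (simp add: field_simps)
  then have "X * (1 - \<tau>) < X * ((y - \<tau>) / ((4 * y\<^sup>2 - 1) / 3))" using X(1) by (rule mult_strict_left_mono)
  then have "X * (1 - \<tau>) / (3 / 2) < X * ((y - \<tau>) / ((4 * y\<^sup>2 - 1) / 3)) / (3 / 2)"
    by (rule divide_strict_right_mono) simp
  also have "\<dots> = X * (y - \<tau>) / (3 / 2 * ((4 * y\<^sup>2 - 1) / 3))"
    by (simp only: times_divide_eq_right divide_divide_eq_left mult.commute)
  finally have "sec_area TYPE('k) (a_star i) t < sec_area TYPE('k) a t"
    unfolding star area by (intro mult_strict_left_mono) auto
  then show ?thesis using a by blast
qed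

text \<open>Uniqueness is asserted below the top level only: at
  \<open>t = sqrt (n / (n + 1))\<close> every section is null, so every \<open>a\<close> is a
  maximizer. The vectors \<open>a_star j\<close> are exactly the coordinate permutations of one of
  them.\<close>

theorem theorem1:
  fixes n :: nat and t :: real and i :: "'m::finite"
  assumes "CARD('m) = n + 1" and "CARD('k::finite) = n - 1"
  shows
   "((3 \<le> n \<and> sqrt ((real n - 1) / (2 * (real n + 1))) < t \<and> t \<le> sqrt (real n / (real n + 1))) \<or>
     (n = 2 \<and> 5 / 4 * (1 / sqrt 6) \<le> t \<and> t \<le> sqrt (2 / 3))
     \<longrightarrow>
       (\<forall>a::real^'m\<in>S_sph. sec_area TYPE('k) a t \<le> sec_area TYPE('k) (a_star i) t) \<and>
       sec_area TYPE('k) (a_star i) t =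
          sqrt (real n + 1) / fact (n - 1) * (real n / (real n + 1)) powr (real n / 2)
            * (sqrt (real n / (real n + 1)) - t) ^ (n - 1) \<and>
       (t < sqrt (real n / (real n + 1)) \<longrightarrow>
          (\<forall>a::real^'m\<in>S_sph. sec_area TYPE('k) a t = sec_area TYPE('k) (a_star i) t
                      \<longrightarrow> (\<exists>j. a = a_star j)))) \<and>
    (n = 2 \<and> 1 / sqrt 6 < t \<and> t < 5 / 4 * (1 / sqrt 6)
     \<longrightarrow> (\<exists>a::real^'m\<in>S_sph. sec_area TYPE('k) a t > sec_area TYPE('k) (a_star i) t))"
proof (intro conjI impI)
  note m = assms(1) and k = assms(2)
  define X where "X = sqrt (real n / (real n + 1))"
  assume H: "(3 \<le> n \<and> sqrt ((real n - 1) / (2 * (real n + 1))) < t \<and> t \<le> sqrt (real n / (real n + 1))) \<or>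
     (n = 2 \<and> 5 / 4 * (1 / sqrt 6) \<le> t \<and> t \<le> sqrt (2 / 3))"
  then have n: "2 \<le> n" by auto
  have "sqrt ((real n - 1) / (2 * (real n + 1))) < t \<and> t \<le> X \<and> (3 \<le> n \<or> 5 / 8 * X \<le> t)"
    using H
  proof
    assume H2: "n = 2 \<and> 5 / 4 * (1 / sqrt 6) \<le> t \<and> t \<le> sqrt (2 / 3)"
    have "sqrt 6 * sqrt (2 / 3) = sqrt (2\<^sup>2)" unfolding real_sqrt_mult[symmetric] by simp
    then have "sqrt (2 / 3) = 2 * (1 / sqrt 6)" by (simp add: field_simps)
    then have "5 / 8 * X \<le> t" using H2 by (simp add: X_def)
    moreover have "0 < 1 / sqrt (6::real)" by simp
    then have "1 / sqrt 6 < t" using H2 by linarith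
    ultimately show ?thesis using H2 by (simp add: X_def real_sqrt_divide)
  qed (auto simp: X_def)
  then have t: "sqrt ((real n - 1) / (2 * (real n + 1))) < t" "t \<le> X" "3 \<le> n \<or> 5 / 8 * X \<le> t"
    by auto
  have t0: "0 < t" using t(1) n by (intro le_less_trans[OF real_sqrt_ge_zero t(1)]) auto
  note star = sec_area_a_star[OF m k n t0, folded X_def, OF t(2)]
  have sph: "a_star j \<in> S_sph" for j :: 'm by (rule a_star_in_S_sph[OF m n])
  note less = sec_area_less_a_star[OF m k n, folded X_def, OF _ t(1) _ t(3)]
  show "\<forall>a::real^'m\<in>S_sph. sec_area TYPE('k) a t \<le> sec_area TYPE('k) (a_star i) t"
  proof
    fix a :: "real^'m" assume a: "a \<in> S_sph"
    show "sec_area TYPE('k) a t \<le> sec_area TYPE('k) (a_star i) t"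
    proof (cases "\<exists>j. a = a_star j")
      case True
      then show ?thesis using star by auto
    next
      case False
      show ?thesis
      proof (cases "t < X")
        case True
        then show ?thesis using less[OF a True] False by (auto intro: less_imp_le)
      next
        case ge: False
        \<comment> \<open>Here \<open>t = X\<close>, and no coordinate exceeds the
          circumradius.\<close>
        have "a $ j \<le> t" for j
        proof (rule ccontr)
          assume "\<not> a $ j \<le> t"
          then have j: "X < a $ j" using ge by simp
          have "a $ h < a $ j" if "h \<noteq> j" for h
            using S_sph_not_two_large[OF m n a t(1) that] j ge t(2) by auto
          then have "a $ j / X \<le> 1" using S_sph_prod_bound(2)[OF m n a, of j] by (simp add: X_def)
          then show False using j a_star_nth(1)[OF m n] by (simp add: X_def field_simps)
        qed
        then have "sec_area TYPE('k) a t = 0"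
          by (rule sec_area_eq_0) (rule S_sph_not_two_large[OF m n a t(1)])
        moreover have "0 \<le> sec_area TYPE('k) (a_star i) t" by (simp add: sec_area_def flat_vol_def)
        ultimately show ?thesis by simp
      qed
    qed
  qed
  have "X ^ n = (real n / (real n + 1)) powr (real n / 2)"
    using n by (simp add: X_def powr_half_sqrt[symmetric] powr_realpow[symmetric] powr_powr)
  then show "sec_area TYPE('k) (a_star i) t =
          sqrt (real n + 1) / fact (n - 1) * (real n / (real n + 1)) powr (real n / 2)
            * (sqrt (real n / (real n + 1)) - t) ^ (n - 1)"
    using star by (simp add: X_def)
  assume "t < sqrt (real n / (real n + 1))"
  then show "\<forall>a::real^'m\<in>S_sph. sec_area TYPE('k) a t = sec_area TYPE('k) (a_star i) t
                      \<longrightarrow> (\<exists>j. a = a_star j)"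
    using less by (metis X_def less_irrefl)
next
  assume "n = 2 \<and> 1 / sqrt 6 < t \<and> t < 5 / 4 * (1 / sqrt 6)"
  then show "\<exists>a::real^'m\<in>S_sph. sec_area TYPE('k) a t > sec_area TYPE('k) (a_star i) t"
    using sec_area_exceeds_a_star_2[where 'k = 'k, of t i] assms by auto
qed

end
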